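(* Let $G=G([n],E)$ be a simple graph. If $\mathbf{x}^{\mathbf{a}}$ is a standard monomial of $T_G$ then $\mathbf{b}(T_{\mathbf{a}})=\mathbf{a}$, and if $T$ is an $\mathbf{r}$-rooted spanning tree of $G_{\mathbf{r}}$ then $T_{\mathbf{b}(T)}=T$. Hence $\mathbf{a}\mapsto T_{\mathbf{a}}$ and $T\mapsto\mathbf{b}(T)$ are mutually inverse bijections between the exponent vectors of standard monomials of $T_G$ and the $\mathbf{r}$-rooted spanning trees of $G_{\mathbf{r}}$ (equivalently, rooted spanning forests of $G$), each non-crossing tree corresponding to a uniquely determined object of each kind.
   Context: Work in $\mathbf{k}[x_1,\dots,x_n]$. For $\sigma\subseteq[n]$, $i\in\sigma$, let $\mathrm{deg}^{\mathrm{out}}_\sigma(i)=|\{j\notin\sigma:\{i,j\}\in E\}|$; $T_G$ is the monomial ideal generated by $\prod_{i\in\sigma}x_i^{\mathrm{deg}^{\mathrm{out}}_\sigma(i)+1}$ over nonempty $\sigma$ with $G[\sigma]$ connected; a standard monomial is a monomial not in $T_G$. $G_{\mathbf{r}}$ is $G$ with an added vertex $\mathbf{r}$ adjacent to all vertices; $N_{G_{\mathbf{r}}}(j)$ denotes neighborhoods in $G_{\mathbf{r}}$; rooted spanning trees have edges directed towards the root $\mathbf{r}$. Construction $T_{\mathbf{a}}$: set $f_{\mathbf{a}}(0)=\mathbf{r}$, $K=\{0\}$, $E(T_{\mathbf{a}})=\emptyset$. For $i=1,\dots,n$ (with $K=\{0,\dots,i-1\}$): among all pairs $(k,j)$ with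 $k\in K$, $j\in[n]\setminus f_{\mathbf{a}}[K]$, and $k=l_{a_j}$ where $l_0<\dots<l_m$ lists $f_{\mathbf{a}}^{-1}[N_{G_{\mathbf{r}}}(j)\cap f_{\mathbf{a}}[K]]$, choose the lexicographically maximal pair $(k,j)$; set $f_{\mathbf{a}}(i)=j$, add the edge $(j,f_{\mathbf{a}}(k))$ to $E(T_{\mathbf{a}})$, and add $i$ to $K$. (It is known that for a standard monomial such a pair exists at every step, so $T_{\mathbf{a}}$ is an $\mathbf{r}$-rooted spanning tree of $G_{\mathbf{r}}$.) Construction $\mathbf{b}(T)$: for an $\mathbf{r}$-rooted spanning tree $T$ of $G_{\mathbf{r}}$, let $p$ be the unique bijection $[n]\sqcup\{\mathbf{r}\}\to\{0,\dots,n\}$ such that $(u,v)\in E(T)\Rightarrow p(v)<p(u)$, such that for edges $(i,k),(j,k)$ of $T$ with $i<j$ one has $p(i)>p(j)$, and such that no two edges $(u,v),(u',v')$ of $T$ satisfy $p(v)<p(v')<p(u)<p(u')$ (i.e., drawing each edge as a semicircle over $[p(v),p(u)]$ in the upper half-plane gives no crossings); such $p$ exists and is unique. For $i\in[n]$ with unique edge $(i,i_{\mathbf{r}})$ in $T$, set $b(T)_i=|\{j\in N_{G_{\mathbf{r}}}(i):p(j)<p(i_{\mathbf{r}})\}|$. (It is known that $\mathbf{x}^{\mathbf{b}(T)}$ is a standard monomial of $T_G$.) *)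

theory Defs
  imports "HOL-Library.Poly_Mapping" "HOL-Library.Product_Lexorder" "HOL-Library.FuncSet"
    "HOL-Algebra.Ideal"
begin

text \<open>Graphs are given by their set of edges, an edge being a two-element set of vertices. The
  vertices of \<open>G\<close> are \<open>1, \<dots>, n\<close>; the additional vertex of \<open>G\<^sub>r\<close> is represented by \<open>0\<close>.\<close>

definition simple_graph :: "nat \<Rightarrow> nat set set \<Rightarrow> bool" where
  "simple_graph n E \<longleftrightarrow> E \<subseteq> {{i, j} | i j. i \<in> {1..n} \<and> j \<in> {1..n} \<and> i \<noteq> j}"

abbreviation (input) root_vertex :: nat where
  "root_vertex \<equiv> 0"

definition coned_edges :: "nat \<Rightarrow> nat set set \<Rightarrow> nat set set" where
  "coned_edges n E = E \<union> {{root_vertex, j} | j. j \<in> {1..n}}"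

definition coned_nbrs :: "nat \<Rightarrow> nat set set \<Rightarrow> nat \<Rightarrow> nat set" where
  "coned_nbrs n E j = {u. {j, u} \<in> coned_edges n E}"

definition linked_within :: "'v set \<Rightarrow> 'v set set \<Rightarrow> ('v \<times> 'v) set" where
  "linked_within S F = {(u, v). u \<in> S \<and> v \<in> S \<and> {u, v} \<in> F}\<^sup>*"

definition connected_graph :: "'v set \<Rightarrow> 'v set set \<Rightarrow> bool" where
  "connected_graph S F \<longleftrightarrow> (\<forall>u\<in>S. \<forall>v\<in>S. (u, v) \<in> linked_within S F)"

definition acyclic_graph :: "'v set set \<Rightarrow> bool" where
  "acyclic_graph F \<longleftrightarrow>
     \<not> (\<exists>c. length c \<ge> 3 \<and> distinct c \<and>
            (\<forall>i. Suc i < length c \<longrightarrow> {c ! i, c ! Suc i} \<in> F) \<and> {last c, hd c} \<in> F)"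

text \<open>A polynomial is a finitely supported map from exponents (themselves finitely supported)
  to coefficients; the ring in the variables \<open>1, \<dots>, n\<close> is a subring of this type.\<close>

definition poly_ring :: "nat \<Rightarrow> ((nat \<Rightarrow>\<^sub>0 nat) \<Rightarrow>\<^sub>0 'k::field) ring" where
  "poly_ring n =
     \<lparr>carrier = {q. \<forall>m \<in> Poly_Mapping.keys q. Poly_Mapping.keys m \<subseteq> {1..n}},
      mult = (*), one = 1, zero = 0, add = (+)\<rparr>"

definition var :: "nat \<Rightarrow> (nat \<Rightarrow>\<^sub>0 nat) \<Rightarrow>\<^sub>0 'k::field" where
  "var i = Poly_Mapping.single (Poly_Mapping.single i 1) 1"

definition out_degree :: "nat \<Rightarrow> nat set set \<Rightarrow> nat set \<Rightarrow> nat \<Rightarrow> nat" where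
  "out_degree n E \<sigma> i = card {j \<in> {1..n}. j \<notin> \<sigma> \<and> {i, j} \<in> E}"

definition tree_ideal :: "nat \<Rightarrow> nat set set \<Rightarrow> ((nat \<Rightarrow>\<^sub>0 nat) \<Rightarrow>\<^sub>0 'k::field) set" where
  "tree_ideal n E =
     genideal (poly_ring n)
       {\<Prod>i\<in>\<sigma>. var i ^ (out_degree n E \<sigma> i + 1) | \<sigma>.
          \<sigma> \<subseteq> {1..n} \<and> \<sigma> \<noteq> {} \<and> connected_graph \<sigma> E}"

definition standard_exponents :: "'k::field itself \<Rightarrow> nat \<Rightarrow> nat set set \<Rightarrow> (nat \<Rightarrow> nat) set" where
  "standard_exponents _ n E =
     {a \<in> {1..n} \<rightarrow>\<^sub>E UNIV. (\<Prod>i\<in>{1..n}. var i ^ a i) \<notin> (tree_ideal n E :: (_ \<Rightarrow>\<^sub>0 'k) set)}"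

text \<open>Rooted trees and forests are sets of directed edges \<open>(u, v)\<close>, pointing towards the root.\<close>

definition underlying :: "('v \<times> 'v) set \<Rightarrow> 'v set set" where
  "underlying T = {{u, v} | u v. (u, v) \<in> T}"

definition rooted_spanning_trees :: "nat \<Rightarrow> nat set set \<Rightarrow> (nat \<times> nat) set set" where
  "rooted_spanning_trees n E =
     {T. underlying T \<subseteq> coned_edges n E \<and>
         connected_graph {0..n} (underlying T) \<and> acyclic_graph (underlying T) \<and>
         asym T \<and> (\<forall>u\<in>{0..n}. (u, root_vertex) \<in> T\<^sup>*)}"

text \<open>A rooted spanning forest is a spanning forest, directed towards the roots, together with its
  set of roots, one for each connected component.\<close>

definition rooted_spanning_forests ::
  "nat \<Rightarrow> nat set set \<Rightarrow> ((nat \<times> nat) set \<times> nat set) set" where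
  "rooted_spanning_forests n E =
     {(F, R). underlying F \<subseteq> E \<and> acyclic_graph (underlying F) \<and> asym F \<and> R \<subseteq> {1..n} \<and>
         (\<forall>u\<in>{1..n}. (\<exists>!s. s \<in> R \<and> (u, s) \<in> linked_within {1..n} (underlying F)) \<and>
                      (\<exists>s\<in>R. (u, s) \<in> F\<^sup>*))}"

definition forest_of_tree :: "(nat \<times> nat) set \<Rightarrow> (nat \<times> nat) set \<times> nat set" where
  "forest_of_tree T = ({(u, v) \<in> T. v \<noteq> root_vertex}, {u. (u, root_vertex) \<in> T})"

definition candidates ::
  "nat \<Rightarrow> nat set set \<Rightarrow> (nat \<Rightarrow> nat) \<Rightarrow> (nat \<Rightarrow> nat) \<Rightarrow> nat set \<Rightarrow> (nat \<times> nat) set" where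
  "candidates n E a f K =
     {(k, j). k \<in> K \<and> j \<in> {1..n} - f ` K \<and>
        (let l = sorted_list_of_set {k' \<in> K. f k' \<in> coned_nbrs n E j}
         in a j < length l \<and> k = l ! a j)}"

text \<open>The state after step \<open>i\<close> consists of the function \<open>f\<close>, meaningful on \<open>K = {0..i}\<close> only, and
  the edges found so far. \<open>Max\<close> refers to the lexicographic order on pairs.\<close>

primrec tree_state ::
  "nat \<Rightarrow> nat set set \<Rightarrow> (nat \<Rightarrow> nat) \<Rightarrow> nat \<Rightarrow> (nat \<Rightarrow> nat) \<times> (nat \<times> nat) set" where
  "tree_state n E a 0 = (\<lambda>_. root_vertex, {})"
| "tree_state n E a (Suc i) =
     (let (f, T) = tree_state n E a i;
          (k, j) = Max (candidates n E a f {0..i})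
      in (f(Suc i := j), insert (j, f k) T))"

definition tree_of_exponent :: "nat \<Rightarrow> nat set set \<Rightarrow> (nat \<Rightarrow> nat) \<Rightarrow> (nat \<times> nat) set" where
  "tree_of_exponent n E a = snd (tree_state n E a n)"

definition noncrossing_labelling :: "nat \<Rightarrow> (nat \<times> nat) set \<Rightarrow> (nat \<Rightarrow> nat) \<Rightarrow> bool" where
  "noncrossing_labelling n T p \<longleftrightarrow>
     p \<in> extensional {0..n} \<and> bij_betw p {0..n} {0..n} \<and>
     (\<forall>u v. (u, v) \<in> T \<longrightarrow> p v < p u) \<and>
     (\<forall>i j k. (i, k) \<in> T \<and> (j, k) \<in> T \<and> i < j \<longrightarrow> p i > p j) \<and>
     \<not> (\<exists>u v u' v'. (u, v) \<in> T \<and> (u', v') \<in> T \<and> p v < p v' \<and> p v' < p u \<and> p u < p u')"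

definition noncrossing_trees ::
  "nat \<Rightarrow> nat set set \<Rightarrow> ((nat \<times> nat) set \<times> (nat \<Rightarrow> nat)) set" where
  "noncrossing_trees n E =
     {(T, p). T \<in> rooted_spanning_trees n E \<and> noncrossing_labelling n T p}"

definition exponent_of_tree :: "nat \<Rightarrow> nat set set \<Rightarrow> (nat \<times> nat) set \<Rightarrow> nat \<Rightarrow> nat" where
  "exponent_of_tree n E T =
     (let p = (THE p. noncrossing_labelling n T p)
      in (\<lambda>i\<in>{1..n}. card {j \<in> coned_nbrs n E i. p j < p (THE v. (i, v) \<in> T)}))"

end

theory Submission
  imports Defs
begin

text \<open>
  Both constructions are depth-first traversals. For a rooted tree \<open>T\<close>, the labelling \<open>p\<close> is
  non-crossing with decreasing siblings if and only if its inverse \<open>f\<close> always visits next the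
  unvisited vertex \<open>j\<close> for which the pair of the position of its parent and \<open>j\<close> itself is
  lexicographically maximal; this gives existence and uniqueness of \<open>p\<close>. In the construction of
  \<open>T\<^sub>a\<close>, the pair \<open>(k, j)\<close> is a candidate precisely when \<open>f k\<close> is a neighbour of \<open>j\<close> with exactly
  \<open>a j\<close> neighbours of \<open>j\<close> visited before it. So the candidates are the possible next steps of the
  traversal of \<open>T\<^sub>a\<close>, and \<open>a j\<close> is recovered by counting the neighbours of \<open>j\<close> that precede its
  parent.
\<close>

subsection \<open>Monomials in the tree ideal\<close>

text \<open>For \<open>j\<close> in \<sigma>, the generator exponent \<open>out_degree + 1\<close>
  is the number of neighbours of \<open>j\<close> outside \<sigma> in the coned graph, the 1 being
  the root. So a monomial lies in the ideal iff some connected \<sigma> has \<open>a j\<close> at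
  least this number for each of its vertices. The same count serves in both directions: the
  construction of a tree gets stuck only if a component of the unvisited vertices is such a
  \<sigma>, and for the exponent of a tree the vertex of \<sigma> with the least label rules
  \<sigma> out. Trees are specified through undirected cycles, which are awkward for a construction
  that adds one edge at a time; they are replaced by parent relations in which every vertex leads to
  the root.\<close>

lemma ring_poly_ring: "ring (poly_ring n :: ((nat \<Rightarrow>\<^sub>0 nat) \<Rightarrow>\<^sub>0 'k::field) ring)"
proof (rule ringI)
  let ?C = "{q :: (nat \<Rightarrow>\<^sub>0 nat) \<Rightarrow>\<^sub>0 'k. \<forall>m\<in>Poly_Mapping.keys q. Poly_Mapping.keys m \<subseteq> {1..n}}"
  have add: "p + q \<in> ?C" if "p \<in> ?C" "q \<in> ?C" for p q :: "(nat \<Rightarrow>\<^sub>0 nat) \<Rightarrow>\<^sub>0 'k"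
    using that keys_add[of p q] by blast
  have mult: "p * q \<in> ?C" if "p \<in> ?C" "q \<in> ?C" for p q :: "(nat \<Rightarrow>\<^sub>0 nat) \<Rightarrow>\<^sub>0 'k"
  proof -
    have "Poly_Mapping.keys m \<subseteq> {1..n}" if "m \<in> Poly_Mapping.keys (p * q)" for m
    proof -
      obtain a b where "m = a + b" "a \<in> Poly_Mapping.keys p" "b \<in> Poly_Mapping.keys q"
        using \<open>m \<in> _\<close> keys_mult[of p q] by blast
      then show ?thesis using keys_add[of a b] \<open>p \<in> ?C\<close> \<open>q \<in> ?C\<close> by blast
    qed
    then show ?thesis by blast
  qed
  have neg: "- p \<in> ?C" if "p \<in> ?C" for p :: "(nat \<Rightarrow>\<^sub>0 nat) \<Rightarrow>\<^sub>0 'k"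
    using that by (simp add: in_keys_iff)
  show "abelian_group (poly_ring n :: ((nat \<Rightarrow>\<^sub>0 nat) \<Rightarrow>\<^sub>0 'k) ring)"
  proof (rule abelian_groupI)
    fix x assume "x \<in> carrier (poly_ring n :: ((nat \<Rightarrow>\<^sub>0 nat) \<Rightarrow>\<^sub>0 'k) ring)"
    then show "\<exists>y\<in>carrier (poly_ring n). y \<oplus>\<^bsub>poly_ring n\<^esub> x = \<zero>\<^bsub>poly_ring n\<^esub>"
      using neg[of x] by (intro bexI[of _ "- x"]) (simp_all add: poly_ring_def)
  qed (simp_all only: poly_ring_def ring.simps monoid.simps partial_object.simps
      add.assoc add_0_left add, simp_all add: add.commute)
  show "Group.monoid (poly_ring n :: ((nat \<Rightarrow>\<^sub>0 nat) \<Rightarrow>\<^sub>0 'k) ring)"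
    by (rule monoidI) (simp_all only: poly_ring_def ring.simps monoid.simps partial_object.simps
        mult.assoc mult_1_left mult_1_right mult, simp)
qed (simp_all add: poly_ring_def algebra_simps)

lemma prod_var_power:
  assumes "finite S"
  shows "(\<Prod>i\<in>S. var i ^ e i) =
    (Poly_Mapping.single (\<Sum>i\<in>S. Poly_Mapping.single i (e i)) 1 :: (nat \<Rightarrow>\<^sub>0 nat) \<Rightarrow>\<^sub>0 'k::field)"
proof -
  have var: "var i ^ m = (Poly_Mapping.single (Poly_Mapping.single i m) 1 :: (nat \<Rightarrow>\<^sub>0 nat) \<Rightarrow>\<^sub>0 'k)" for i m
    by (induction m) (simp_all add: var_def mult_single flip: single_add)
  show ?thesis using assms
    by (induction rule: finite_induct) (simp_all add: var mult_single)
qed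

lemma lookup_sum_single:
  assumes "finite S"
  shows "Poly_Mapping.lookup (\<Sum>i\<in>S. Poly_Mapping.single i (e i)) j = (if j \<in> S then e j else 0)"
  using assms by (simp add: lookup_sum lookup_single when_def)

text \<open>Divisibility of the monomial with exponents \<open>a\<close> by a generator, as a purely
  combinatorial condition; the strict inequality absorbs the \<open>+ 1\<close> in the exponent of
  the generator.\<close>

definition generator_divides :: "nat \<Rightarrow> nat set set \<Rightarrow> (nat \<Rightarrow> nat) \<Rightarrow> bool" where
  "generator_divides n E a \<longleftrightarrow>
     (\<exists>\<sigma>. \<sigma> \<subseteq> {1..n} \<and> \<sigma> \<noteq> {} \<and> connected_graph \<sigma> E \<and> (\<forall>i\<in>\<sigma>. out_degree n E \<sigma> i < a i))"

lemma generator_divides_mono: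
  assumes "generator_divides n E a" "\<And>i. i \<in> {1..n} \<Longrightarrow> a i \<le> b i"
  shows "generator_divides n E b"
  using assms unfolding generator_divides_def by (meson less_le_trans subsetD)

text \<open>Keys of a product are sums of keys of the factors, so they stay divisible by a
  generator; keys of a sum come from the summands. This ideal serves as an upper bound for
  \<open>tree_ideal\<close> in which membership of a monomial can be read off.\<close>

lemma generator_divides_ideal:
  "ideal {q \<in> carrier (poly_ring n). \<forall>m\<in>Poly_Mapping.keys q.
      generator_divides n E (Poly_Mapping.lookup m)}
    (poly_ring n :: ((nat \<Rightarrow>\<^sub>0 nat) \<Rightarrow>\<^sub>0 'k::field) ring)" (is "ideal ?I ?R")
proof (rule idealI)
  interpret ring ?R by (rule ring_poly_ring)
  show "ring ?R" ..
  have mult: "x * p \<in> ?I" if "p \<in> ?I" "x \<in> carrier ?R" for x p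
  proof -
    have "x * p \<in> carrier ?R" using m_closed[of x p] that by (simp add: poly_ring_def)
    moreover have "generator_divides n E (Poly_Mapping.lookup m)"
      if "m \<in> Poly_Mapping.keys (x * p)" for m
    proof -
      obtain a b where ab: "m = a + b" "b \<in> Poly_Mapping.keys p"
        using \<open>m \<in> _\<close> keys_mult[of x p] by blast
      then have "generator_divides n E (Poly_Mapping.lookup b)" using \<open>p \<in> ?I\<close> by blast
      then show ?thesis by (rule generator_divides_mono) (simp add: ab lookup_add)
    qed
    ultimately show ?thesis by blast
  qed
  have "x \<otimes>\<^bsub>?R\<^esub> p = x * p" "p \<otimes>\<^bsub>?R\<^esub> x = x * p" for x p
    by (simp_all add: poly_ring_def mult.commute)
  then show "x \<otimes>\<^bsub>?R\<^esub> p \<in> ?I" "p \<otimes>\<^bsub>?R\<^esub> x \<in> ?I" if "p \<in> ?I" "x \<in> carrier ?R" for x p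
    using mult[OF that] by metis+
  show "subgroup ?I (add_monoid ?R)"
  proof (rule add.subgroupI)
    have "0 \<in> ?I" by (simp add: poly_ring_def)
    then show "?I \<noteq> {}" by blast
    show "p \<oplus>\<^bsub>?R\<^esub> q \<in> ?I" if "p \<in> ?I" "q \<in> ?I" for p q
    proof -
      have "p \<in> carrier ?R" "q \<in> carrier ?R" using that by blast+
      then have "p \<oplus>\<^bsub>?R\<^esub> q \<in> carrier ?R" by (rule a_closed)
      then have "p + q \<in> carrier ?R" by (simp add: poly_ring_def)
      moreover have "generator_divides n E (Poly_Mapping.lookup m)"
        if "m \<in> Poly_Mapping.keys (p + q)" for m
        using subsetD[OF keys_add that] \<open>p \<in> ?I\<close> \<open>q \<in> ?I\<close> by auto
      ultimately have "p + q \<in> ?I" by blast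
      moreover have "p \<oplus>\<^bsub>?R\<^esub> q = p + q" by (simp add: poly_ring_def)
      ultimately show ?thesis by metis
    qed
    show "\<ominus>\<^bsub>?R\<^esub> p \<in> ?I" if p: "p \<in> ?I" for p
    proof -
      have c: "- p \<in> carrier ?R" using p by (simp add: poly_ring_def in_keys_iff)
      then have "\<ominus>\<^bsub>?R\<^esub> p = - p"
        using p by (intro minus_equality) (simp_all add: poly_ring_def)
      moreover have "- p \<in> ?I" using p c by (simp add: in_keys_iff)
      ultimately show ?thesis by metis
    qed
  qed auto
qed

text \<open>As an intersection of ideals, \<open>tree_ideal\<close> is contained in the ideal of
  polynomials all of whose monomials are divisible by a generator. Conversely, a divisible monomial
  is a generator times a monomial.\<close>

lemma monomial_in_tree_ideal_iff:
  "(\<Prod>i\<in>{1..n}. var i ^ a i) \<in> (tree_ideal n E :: ((nat \<Rightarrow>\<^sub>0 nat) \<Rightarrow>\<^sub>0 'k::field) set) \<longleftrightarrow>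
    generator_divides n E a"
proof
  let ?R = "poly_ring n :: ((nat \<Rightarrow>\<^sub>0 nat) \<Rightarrow>\<^sub>0 'k) ring"
  let ?gen = "\<lambda>\<sigma>. (\<Prod>i\<in>\<sigma>. var i ^ (out_degree n E \<sigma> i + 1)) :: (nat \<Rightarrow>\<^sub>0 nat) \<Rightarrow>\<^sub>0 'k"
  let ?S = "{?gen \<sigma> | \<sigma>. \<sigma> \<subseteq> {1..n} \<and> \<sigma> \<noteq> {} \<and> connected_graph \<sigma> E}"
  have monom_carrier: "(\<Prod>i\<in>S. (var i :: (nat \<Rightarrow>\<^sub>0 nat) \<Rightarrow>\<^sub>0 'k) ^ e i) \<in> carrier ?R" if "S \<subseteq> {1..n}" for S e
    using that finite_subset[OF that]
    by (auto simp: prod_var_power poly_ring_def in_keys_iff lookup_sum_single split: if_splits)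
  {
    assume "(\<Prod>i\<in>{1..n}. var i ^ a i) \<in> (tree_ideal n E :: ((nat \<Rightarrow>\<^sub>0 nat) \<Rightarrow>\<^sub>0 'k) set)"
    moreover let ?I = "{q \<in> carrier ?R. \<forall>m\<in>Poly_Mapping.keys q.
      generator_divides n E (Poly_Mapping.lookup m)}"
    have "?S \<subseteq> ?I"
    proof
      fix q assume "q \<in> ?S"
      then obtain \<sigma> where \<sigma>: "q = ?gen \<sigma>" "\<sigma> \<subseteq> {1..n}" "\<sigma> \<noteq> {}" "connected_graph \<sigma> E" by blast
      have fin: "finite \<sigma>" using \<sigma>(2) finite_subset by blast
      have "generator_divides n E (Poly_Mapping.lookup
        (\<Sum>i\<in>\<sigma>. Poly_Mapping.single i (out_degree n E \<sigma> i + 1)))"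
        using \<sigma> unfolding generator_divides_def lookup_sum_single[OF fin] by (intro exI[of _ \<sigma>]) simp
      moreover have "q \<in> carrier ?R" unfolding \<sigma>(1) by (rule monom_carrier[OF \<sigma>(2)])
      ultimately show "q \<in> ?I" using \<sigma>(1) fin by (simp add: prod_var_power del: power_Suc)
    qed
    ultimately have "(\<Prod>i\<in>{1..n}. var i ^ a i) \<in> ?I"
      using generator_divides_ideal[of n E, where 'k = 'k] unfolding tree_ideal_def genideal_def by blast
    then have "generator_divides n E
        (Poly_Mapping.lookup (\<Sum>i\<in>{1..n}. Poly_Mapping.single i (a i)))"
      by (simp add: prod_var_power)
    then show "generator_divides n E a"
      by (rule generator_divides_mono) (simp add: lookup_sum_single)
  }
  assume "generator_divides n E a"
  then obtain \<sigma> where \<sigma>: "\<sigma> \<subseteq> {1..n}" "\<sigma> \<noteq> {}" "connected_graph \<sigma> E"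
    "\<And>i. i \<in> \<sigma> \<Longrightarrow> out_degree n E \<sigma> i < a i" by (auto simp: generator_divides_def)
  \<comment> \<open>The exponents of the generator, padded by 0 outside \<sigma>. Since
    \<open>e i \<le> a i\<close>, the subtraction in the cofactor is never truncated.\<close>
  define e where "e = (\<lambda>i. if i \<in> \<sigma> then out_degree n E \<sigma> i + 1 else 0)"
  have e: "e i \<le> a i" for i using \<sigma>(4) by (auto simp: e_def Suc_le_eq)
  have "?gen \<sigma> = (\<Prod>i\<in>{1..n}. var i ^ e i)"
    using \<sigma>(1) by (intro prod.mono_neutral_cong_left) (auto simp: e_def)
  then have eq: "(\<Prod>i\<in>{1..n}. var i ^ a i) = ?gen \<sigma> * (\<Prod>i\<in>{1..n}. var i ^ (a i - e i))"
    using e by (simp flip: prod.distrib power_add)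
  show "(\<Prod>i\<in>{1..n}. var i ^ a i) \<in> (tree_ideal n E :: ((nat \<Rightarrow>\<^sub>0 nat) \<Rightarrow>\<^sub>0 'k) set)"
    unfolding tree_ideal_def genideal_def
  proof (rule InterI, elim CollectE conjE)
    fix I assume I: "ideal I ?R" "?S \<subseteq> I"
    have "?gen \<sigma> \<in> I" using I(2) \<sigma>(1-3) by blast
    then have "?gen \<sigma> \<otimes>\<^bsub>?R\<^esub> (\<Prod>i\<in>{1..n}. var i ^ (a i - e i)) \<in> I"
      by (rule ideal.I_r_closed[OF I(1)]) (rule monom_carrier[OF order_refl])
    then show "(\<Prod>i\<in>{1..n}. var i ^ a i) \<in> I" unfolding eq by (simp add: poly_ring_def)
  qed
qed

subsection \<open>Rooted spanning trees as parent functions\<close>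

text \<open>The path grows edge by edge; on meeting an old vertex it is cut back to that vertex. The
  bound on \<open>set c\<close> keeps vertices other than \<open>x\<close> that lie outside
  \<open>Range R\<close> off the path.\<close>

lemma rtrancl_distinct_path:
  assumes "(x, y) \<in> R\<^sup>*"
  shows "\<exists>c. c \<noteq> [] \<and> distinct c \<and> hd c = x \<and> last c = y \<and> set c \<subseteq> insert x (Range R) \<and>
    (\<forall>i. Suc i < length c \<longrightarrow> (c ! i, c ! Suc i) \<in> R)"
  using assms
proof (induction rule: rtrancl_induct)
  case base
  show ?case by (rule exI[of _ "[x]"]) simp
next
  case (step y z)
  then obtain c where c: "c \<noteq> []" "distinct c" "hd c = x" "last c = y" "set c \<subseteq> insert x (Range R)"
    "\<And>i. Suc i < length c \<Longrightarrow> (c ! i, c ! Suc i) \<in> R" by blast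
  show ?case
  proof (cases "z \<in> set c")
    case True
    then obtain m where m: "m < length c" "c ! m = z" by (auto simp: in_set_conv_nth)
    have "last (take (Suc m) c) = z"
      using m by (simp add: take_Suc_conv_app_nth)
    then show ?thesis using c m
      by (intro exI[of _ "take (Suc m) c"]) (auto simp: hd_take dest!: in_set_takeD)
  next
    case False
    have "((c @ [z]) ! i, (c @ [z]) ! Suc i) \<in> R" if "Suc i < length (c @ [z])" for i
    proof (cases "Suc i = length c")
      case True
      then have "c ! i = y" using c(1,4) by (metis diff_Suc_1 last_conv_nth)
      then show ?thesis using step(2) True by (simp add: nth_append)
    next
      case False
      then show ?thesis using c(6)[of i] that by (simp add: nth_append)
    qed
    then show ?thesis using c False step(2)
      by (intro exI[of _ "c @ [z]"]) auto
  qed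
qed

section \<open>Directed and undirected acyclicity\<close>

lemma underlyingI: "(u, v) \<in> F \<Longrightarrow> {u, v} \<in> underlying F" "(u, v) \<in> F \<Longrightarrow> {v, u} \<in> underlying F"
  by (auto simp: underlying_def insert_commute)

lemma underlyingD: "{u, v} \<in> underlying F \<Longrightarrow> (u, v) \<in> F \<or> (v, u) \<in> F"
  by (auto simp: underlying_def doubleton_eq_iff)

text \<open>\<open>acyclic_graph\<close> only sees cycles on at least three vertices;
  \<open>asym\<close> takes care of loops and of pairs of opposite edges.\<close>

lemma acyclic_graph_imp_acyclic:
  assumes "acyclic_graph (underlying F)" "asym F"
  shows "acyclic F"
proof (rule acyclicI, intro allI notI)
  fix x assume "(x, x) \<in> F\<^sup>+"
  then obtain y where y: "(x, y) \<in> F" "(y, x) \<in> F\<^sup>*" by (meson tranclD)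
  obtain c where c: "c \<noteq> []" "distinct c" "hd c = y" "last c = x"
    "\<And>i. Suc i < length c \<Longrightarrow> (c ! i, c ! Suc i) \<in> F"
    using rtrancl_distinct_path[OF y(2)] by blast
  have "length c \<noteq> 1"
    using c y(1) asymD[OF assms(2), of x x] by (auto simp: length_Suc_conv)
  moreover have "length c \<noteq> 2"
  proof
    assume "length c = 2"
    then obtain a b where "c = [a, b]" by (auto simp: numeral_2_eq_2 length_Suc_conv)
    then show False using c(3,4) c(5)[of 0] y(1) asymD[OF assms(2)] by auto
  qed
  moreover have "length c \<noteq> 0" using c by simp
  ultimately have "length c \<ge> 3" by linarith
  then show False
    using assms(1) c y(1) underlyingI unfolding acyclic_graph_def by metis
qed

text \<open>The directed paths from \<open>v\<close> and \<open>v'\<close> to \<open>s\<close> avoid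
  \<open>u\<close>, as a return to \<open>u\<close> would close a directed cycle. Distinct
  \<open>v\<close> and \<open>v'\<close> are thus joined by a path without \<open>u\<close>, and
  adding \<open>u\<close> makes it an undirected cycle.\<close>

lemma acyclic_graph_out_edge_unique:
  assumes F: "acyclic_graph (underlying F)" "asym F"
    and e: "(u, v) \<in> F" "(u, v') \<in> F" "(v, s) \<in> F\<^sup>*" "(v', s) \<in> F\<^sup>*"
  shows "v = v'"
proof (rule ccontr)
  assume ne: "v \<noteq> v'"
  \<comment> \<open>Adjacency after deletion of \<open>u\<close>; it is symmetric, so the two paths
    to \<open>s\<close> can be joined at \<open>s\<close>.\<close>
  define R where "R = {(a, b). {a, b} \<in> underlying F \<and> a \<noteq> u \<and> b \<noteq> u}"
  have noloop: "(u, u) \<notin> F\<^sup>+"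
    using acyclic_graph_imp_acyclic[OF F] by (simp add: acyclic_def)
  have reach: "(x, s) \<in> F\<^sup>* \<Longrightarrow> (u, x) \<in> F\<^sup>+ \<longrightarrow> (x, s) \<in> R\<^sup>*" for x
  proof (induction rule: converse_rtrancl_induct)
    case (step x y)
    show ?case
    proof
      assume ux: "(u, x) \<in> F\<^sup>+"
      then have uy: "(u, y) \<in> F\<^sup>+" using step(1) by auto
      then have "(x, y) \<in> R"
        using ux noloop step(1) by (auto simp: R_def underlyingI)
      then show "(x, s) \<in> R\<^sup>*" using step.IH uy by auto
    qed
  qed auto
  have "sym R" by (auto simp: R_def sym_def insert_commute)
  then have "(s, v') \<in> R\<^sup>*" using reach[OF e(4)] e(2) by (meson r_into_trancl' symD sym_rtrancl)
  then have "(v, v') \<in> R\<^sup>*" using reach[OF e(3)] e(1) by auto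
  then obtain c where c: "c \<noteq> []" "distinct c" "hd c = v" "last c = v'" "set c \<subseteq> insert v (Range R)"
    "\<And>i. Suc i < length c \<Longrightarrow> (c ! i, c ! Suc i) \<in> R" 
    using rtrancl_distinct_path[of v v' R] by blast
  have "v \<noteq> u" using noloop e(1) by auto
  then have "u \<notin> set c" using c(5) by (auto simp: R_def)
  moreover have "length c \<ge> 2"
    using c(1,3,4) ne by (cases c; cases "tl c") auto
  moreover have "{(u # c) ! i, (u # c) ! Suc i} \<in> underlying F" if "Suc i < length (u # c)" for i
  proof (cases i)
    case 0
    then show ?thesis using c(1,3) e(1) by (simp add: hd_conv_nth underlyingI)
  next
    case (Suc m)
    then show ?thesis using c(6)[of m] that by (simp add: R_def)
  qed
  moreover have "{last (u # c), hd (u # c)} \<in> underlying F"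
    using c(1,4) e(2) by (simp add: underlyingI)
  ultimately show False
    using F(1) c(2) unfolding acyclic_graph_def
    by (auto dest!: spec[of _ "u # c"])
qed

text \<open>The parent function of a rooted tree as a relation: \<open>Domain T = {1..n}\<close>
  leaves exactly the root without a parent, and reachability of the root excludes cycles.\<close>

definition directed_tree :: "nat \<Rightarrow> (nat \<times> nat) set \<Rightarrow> bool" where
  "directed_tree n T \<longleftrightarrow> single_valued T \<and> Domain T = {1..n} \<and> Range T \<subseteq> {0..n} \<and>
     (\<forall>u\<in>{0..n}. (u, 0) \<in> T\<^sup>*)"

text \<open>The height is the length of a shortest path to the root. Such a path from
  \<open>u\<close> begins with the only edge leaving \<open>u\<close>, so its remainder is a shorter
  path from the parent.\<close>

lemma directed_tree_height:
  assumes "directed_tree n T"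
  obtains d :: "nat \<Rightarrow> nat" where "\<And>u v. (u, v) \<in> T \<Longrightarrow> d v < d u"
proof
  fix u v assume uv: "(u, v) \<in> T"
  define d where "d = (\<lambda>u. LEAST m. (u, 0) \<in> T ^^ m)"
  have "u \<in> Domain T" using uv by blast
  then have u: "u \<in> {1..n}" "u \<noteq> 0" using assms by (simp_all add: directed_tree_def)
  then have "(u, 0) \<in> T\<^sup>*" using assms by (auto simp: directed_tree_def)
  then have "\<exists>m. (u, 0) \<in> T ^^ m" by (simp add: rtrancl_power)
  then have du: "(u, 0) \<in> T ^^ d u" unfolding d_def by (rule LeastI_ex)
  then obtain m where m: "d u = Suc m" using u by (cases "d u") auto
  then obtain w where "(u, w) \<in> T" "(w, 0) \<in> T ^^ m" using du by (metis relpow_Suc_D2)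
  then have "(v, 0) \<in> T ^^ m"
    using assms uv by (auto simp: directed_tree_def single_valued_def)
  then have "d v \<le> m" unfolding d_def by (rule Least_le)
  then show "(LEAST m. (v, 0) \<in> T ^^ m) < (LEAST m. (u, 0) \<in> T ^^ m)"
    using m by (simp add: d_def)
qed

text \<open>At a vertex of greatest height on a cycle, both cycle edges must point away from it,
  since the other orientation would give a higher neighbour. Both neighbours are then its parent,
  hence equal.\<close>

lemma acyclic_graph_underlying:
  fixes d :: "'v \<Rightarrow> nat"
  assumes "single_valued T" and d: "\<And>u v. (u, v) \<in> T \<Longrightarrow> d v < d u"
  shows "acyclic_graph (underlying T)"
  unfolding acyclic_graph_def
proof (rule notI, elim exE conjE)
  fix c assume len: "length c \<ge> 3" and dist: "distinct c"
    and path: "\<forall>i. Suc i < length c \<longrightarrow> {c ! i, c ! Suc i} \<in> underlying T"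
    and close: "{last c, hd c} \<in> underlying T"
  have "c \<noteq> []" using len by auto
  have "\<exists>x\<in>set c. \<forall>y\<in>set c. d y \<le> d x"
    using Max_in[of "d ` set c"] Max_ge[of "d ` set c"] \<open>c \<noteq> []\<close>
    by (smt (verit) List.finite_set finite_imageI image_iff image_is_empty set_empty)
  then obtain m where m: "m < length c" and max: "\<And>i. i < length c \<Longrightarrow> d (c ! i) \<le> d (c ! m)"
    by (metis in_set_conv_nth)
  have adj: "{c ! i, c ! (Suc i mod length c)} \<in> underlying T" if "i < length c" for i
  proof (cases "Suc i = length c")
    case True
    then show ?thesis using close \<open>c \<noteq> []\<close> by (simp add: last_conv_nth hd_conv_nth flip: True)
  next
    case False
    then show ?thesis using path that by simp
  qed
  have parent: "(c ! m, c ! i) \<in> T"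
    if "{c ! m, c ! i} \<in> underlying T \<or> {c ! i, c ! m} \<in> underlying T" "i < length c" for i
    using that max[of i] d[of "c ! i" "c ! m"] by (fastforce dest: underlyingD)
  define prev where "prev = (if m = 0 then length c - 1 else m - 1)"
  define nxt where "nxt = (if Suc m = length c then 0 else Suc m)"
  have nxt: "nxt = Suc m mod length c" and prev: "Suc prev mod length c = m"
    using m len by (auto simp: nxt_def prev_def)
  \<comment> \<open>Here the length of at least 3 enters: on two vertices, successor and predecessor
    would coincide.\<close>
  have lt: "nxt < length c" "prev < length c" "nxt \<noteq> prev" using m len
    by (auto simp: nxt_def prev_def split: if_splits)
  have "(c ! m, c ! nxt) \<in> T" using adj[OF m] lt parent unfolding nxt by blast
  moreover have "(c ! m, c ! prev) \<in> T" using adj[OF lt(2)] lt parent unfolding prev by blast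
  ultimately have "c ! nxt = c ! prev" using assms(1) by (auto simp: single_valued_def)
  then show False using dist lt by (simp add: nth_eq_iff_index_eq)
qed

lemma edge_in_coned_edges:
  assumes "simple_graph n E" "{u, v} \<in> coned_edges n E"
  shows "u \<in> {0..n}" "v \<in> {0..n}" "u \<noteq> v" "u \<noteq> 0 \<Longrightarrow> v \<noteq> 0 \<Longrightarrow> {u, v} \<in> E"
proof -
  have "(\<exists>i j. {u, v} = {i, j} \<and> i \<in> {1..n} \<and> j \<in> {1..n} \<and> i \<noteq> j) \<or> (\<exists>j\<in>{1..n}. {u, v} = {0, j})"
    using assms unfolding simple_graph_def coned_edges_def by blast
  then show "u \<in> {0..n}" "v \<in> {0..n}" "u \<noteq> v" by (auto simp: doubleton_eq_iff)
  show "u \<noteq> 0 \<Longrightarrow> v \<noteq> 0 \<Longrightarrow> {u, v} \<in> E"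
    using assms unfolding coned_edges_def by (auto simp: doubleton_eq_iff)
qed

text \<open>Parents are unique by \<open>acyclic_graph_out_edge_unique\<close> with the root as
  common target, and an edge leaving the root would close a directed cycle. Conversely, heights that
  decrease along edges exclude undirected cycles.\<close>

lemma rooted_spanning_trees_iff:
  assumes G: "simple_graph n E"
  shows "T \<in> rooted_spanning_trees n E \<longleftrightarrow> directed_tree n T \<and> underlying T \<subseteq> coned_edges n E"
proof
  assume T: "T \<in> rooted_spanning_trees n E"
  then have und: "underlying T \<subseteq> coned_edges n E" and ac: "acyclic_graph (underlying T)"
    and as: "asym T" and reach: "\<And>u. u \<in> {0..n} \<Longrightarrow> (u, 0) \<in> T\<^sup>*"
    by (auto simp: rooted_spanning_trees_def)
  have edge: "u \<in> {0..n}" "v \<in> {0..n}" if "(u, v) \<in> T" for u v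
    using edge_in_coned_edges[OF G, of u v] und underlyingI(1)[OF that] by auto
  have sv: "single_valued T"
    using acyclic_graph_out_edge_unique[OF ac as] reach edge by (meson single_valuedI)
  have "(0, v) \<notin> T" for v
    using reach[of v] edge[of 0 v] acyclic_graph_imp_acyclic[OF ac as]
    by (metis acyclic_def rtrancl_into_trancl2)
  then have "Domain T \<subseteq> {1..n}" using edge by (fastforce simp: Suc_le_eq intro!: Nat.gr0I)
  moreover have "u \<in> Domain T" if "u \<in> {1..n}" for u
    using reach[of u] that by (auto elim: converse_rtranclE)
  ultimately show "directed_tree n T \<and> underlying T \<subseteq> coned_edges n E"
    using sv und reach edge by (auto simp: directed_tree_def)
next
  assume "directed_tree n T \<and> underlying T \<subseteq> coned_edges n E"
  then have T: "directed_tree n T" and und: "underlying T \<subseteq> coned_edges n E" by auto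
  obtain d :: "nat \<Rightarrow> nat" where d: "\<And>u v. (u, v) \<in> T \<Longrightarrow> d v < d u"
    using directed_tree_height[OF T] by blast
  have ac: "acyclic_graph (underlying T)"
    using acyclic_graph_underlying[OF _ d] T by (auto simp: directed_tree_def)
  have as: "asym T" using d by (meson asymI less_asym)
  let ?R = "{(u, v). u \<in> {0..n} \<and> v \<in> {0..n} \<and> {u, v} \<in> underlying T}"
  have "T \<subseteq> ?R" using T by (fastforce simp: directed_tree_def underlyingI)
  then have "(u, 0) \<in> ?R\<^sup>*" if "u \<in> {0..n}" for u
    using T that rtrancl_mono[of T ?R] by (auto simp: directed_tree_def)
  moreover have "sym (?R\<^sup>*)" by (intro sym_rtrancl) (auto simp: sym_def insert_commute)
  ultimately have "(u, v) \<in> ?R\<^sup>*" if "u \<in> {0..n}" "v \<in> {0..n}" for u v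
    using that by (meson rtrancl_trans symD)
  then have "connected_graph {0..n} (underlying T)"
    by (simp add: connected_graph_def linked_within_def)
  then show "T \<in> rooted_spanning_trees n E"
    using und ac as T by (auto simp: rooted_spanning_trees_def directed_tree_def)
qed

subsection \<open>Depth-first traversals and non-crossing labellings\<close>

text \<open>The counterpart of \<open>candidates\<close> for a known tree: \<open>k\<close> is the
  position of a visited parent of the unvisited \<open>j\<close>. The lexicographic maximum goes
  back to the latest visited vertex that has an unvisited child and takes its largest such
  child.\<close>

definition traversal_steps :: "nat \<Rightarrow> (nat \<times> nat) set \<Rightarrow> (nat \<Rightarrow> nat) \<Rightarrow> nat \<Rightarrow> (nat \<times> nat) set" where
  "traversal_steps n T f i = {(k, j). k \<in> {0..i} \<and> j \<in> {1..n} - f ` {0..i} \<and> (j, f k) \<in> T}"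

text \<open>The bound \<open>m\<close> allows a traversal to be built step by step, with
  \<open>f\<close> arbitrary beyond \<open>m\<close>. Nonemptiness is demanded because
  \<open>Max\<close> of the empty set is unspecified.\<close>

definition depth_first :: "nat \<Rightarrow> (nat \<times> nat) set \<Rightarrow> nat \<Rightarrow> (nat \<Rightarrow> nat) \<Rightarrow> bool" where
  "depth_first n T m f \<longleftrightarrow> f 0 = 0 \<and>
     (\<forall>i<m. traversal_steps n T f i \<noteq> {} \<and> f (Suc i) = snd (Max (traversal_steps n T f i)))"

lemma finite_traversal_steps: "finite (traversal_steps n T f i)"
  by (rule finite_subset[of _ "{0..i} \<times> {1..n}"]) (auto simp: traversal_steps_def)

lemma traversal_steps_cong:
  assumes "\<And>k. k \<le> i \<Longrightarrow> f k = g k"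
  shows "traversal_steps n T f i = traversal_steps n T g i"
proof -
  have "f ` {0..i} = g ` {0..i}" using assms by (intro image_cong) auto
  then show ?thesis using assms by (auto simp: traversal_steps_def)
qed

lemma depth_first_step:
  assumes "depth_first n T m f" "i < m"
  obtains k where "(k, f (Suc i)) \<in> traversal_steps n T f i"
    "\<And>q. q \<in> traversal_steps n T f i \<Longrightarrow> q \<le> (k, f (Suc i))"
proof
  let ?M = "Max (traversal_steps n T f i)"
  have M: "(fst ?M, f (Suc i)) = ?M" "traversal_steps n T f i \<noteq> {}"
    using assms by (auto simp: depth_first_def)
  show "(fst ?M, f (Suc i)) \<in> traversal_steps n T f i"
    unfolding M(1) using M(2) finite_traversal_steps by (rule Max_in[rotated])
  show "q \<le> (fst ?M, f (Suc i))" if "q \<in> traversal_steps n T f i" for q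
    unfolding M(1) using that finite_traversal_steps by (rule Max_ge[rotated])
qed

lemma depth_first_SucI:
  assumes "(k, f (Suc i)) \<in> traversal_steps n T f i"
    and "\<And>q. q \<in> traversal_steps n T f i \<Longrightarrow> q \<le> (k, f (Suc i))"
  shows "traversal_steps n T f i \<noteq> {} \<and> f (Suc i) = snd (Max (traversal_steps n T f i))"
  using assms Max_eqI[OF finite_traversal_steps, of n T f i "(k, f (Suc i))"] by auto

lemma depth_first_inj:
  assumes "depth_first n T m f"
  shows "inj_on f {0..m}" "f ` {0..m} \<subseteq> {0..n}"
proof -
  have new: "f (Suc i) \<in> {1..n} - f ` {0..i}" if "i < m" for i
    by (rule depth_first_step[OF assms that]) (auto simp: traversal_steps_def)
  have "f i \<noteq> f j" if "i < j" "j \<le> m" for i j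
  proof
    assume "f i = f j"
    then have "f (Suc (j - 1)) \<in> f ` {0..j - 1}" using that by (auto intro!: image_eqI[of _ _ i])
    moreover have "j - 1 < m" using that by simp
    ultimately show False using new[of "j - 1"] by blast
  qed
  then show "inj_on f {0..m}" by (metis atLeastAtMost_iff inj_onI nat_neq_iff)
  have "f i \<in> {0..n}" if "i \<le> m" for i
    using new[of "i - 1"] that assms by (cases i) (auto simp: depth_first_def)
  then show "f ` {0..m} \<subseteq> {0..n}" by auto
qed

lemma depth_first_bij:
  assumes "depth_first n T n f"
  shows "bij_betw f {0..n} {0..n}"
  using depth_first_inj[OF assms] by (simp add: bij_betw_def endo_inj_surj)

lemma depth_first_unique:
  assumes "depth_first n T m f" "depth_first n T m g" "i \<le> m"
  shows "f i = g i"
  using assms(3)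
proof (induction i rule: less_induct)
  case (less i)
  show ?case
  proof (cases i)
    case 0
    then show ?thesis using assms by (simp add: depth_first_def)
  next
    case (Suc j)
    then have "traversal_steps n T f j = traversal_steps n T g j"
      using less by (intro traversal_steps_cong) auto
    then show ?thesis using assms Suc less.prems by (simp add: depth_first_def)
  qed
qed

text \<open>The path from an unvisited vertex to the root, which is visited, contains an edge from
  an unvisited to a visited vertex; so the traversal cannot get stuck early.\<close>

lemma depth_first_exists:
  assumes T: "directed_tree n T" and "m \<le> n"
  shows "\<exists>f. depth_first n T m f"
  using assms(2)
proof (induction m)
  case 0
  show ?case by (rule exI[of _ "\<lambda>_. 0"]) (simp add: depth_first_def)
next
  case (Suc m)
  then obtain f where f: "depth_first n T m f" by auto
  have "card (f ` {0..m}) \<le> m + 1" using card_image_le[of "{0..m}" f] by simp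
  then have "\<not> {0..n} \<subseteq> f ` {0..m}" using Suc.prems card_mono[of "f ` {0..m}" "{0..n}"] by auto
  then obtain u where u: "u \<in> {0..n}" "u \<notin> f ` {0..m}" by blast
  have "f 0 = 0" using f by (simp add: depth_first_def)
  then have vis: "0 \<in> f ` {0..m}" by force
  have "(u, 0) \<in> T\<^sup>*" using T u by (simp add: directed_tree_def)
  then have "u \<notin> f ` {0..m} \<longrightarrow> (\<exists>x y. (x, y) \<in> T \<and> x \<notin> f ` {0..m} \<and> y \<in> f ` {0..m})"
    by (induction rule: converse_rtrancl_induct) (use vis in blast)+
  then obtain x k where xk: "(x, f k) \<in> T" "x \<notin> f ` {0..m}" "k \<in> {0..m}" using u by auto
  moreover have "x \<in> {1..n}" using xk T by (auto simp: directed_tree_def)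
  ultimately have ne: "traversal_steps n T f m \<noteq> {}" by (auto simp: traversal_steps_def)
  let ?f = "f(Suc m := snd (Max (traversal_steps n T f m)))"
  have "traversal_steps n T ?f i = traversal_steps n T f i" if "i \<le> m" for i
    using that by (intro traversal_steps_cong) auto
  then have "depth_first n T (Suc m) ?f"
    using f ne by (auto simp: depth_first_def less_Suc_eq)
  then show ?case by blast
qed

text \<open>When \<open>u\<close> is visited, every edge from an unvisited to a visited vertex
  competes with the edge of \<open>u\<close> and does not exceed it. A crossing, or siblings in the
  wrong order, would provide a larger competitor.\<close>

lemma depth_first_noncrossing:
  assumes T: "directed_tree n T" and f: "depth_first n T n f"
    and p: "p \<in> extensional {0..n}" "\<And>i. i \<in> {0..n} \<Longrightarrow> p (f i) = i"
  shows "noncrossing_labelling n T p"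
proof -
  have bij: "bij_betw f {0..n} {0..n}" by (rule depth_first_bij[OF f])
  have fp: "f (p u) = u" "p u \<in> {0..n}" if "u \<in> {0..n}" for u
  proof -
    have "u \<in> f ` {0..n}" using bij that by (simp add: bij_betw_def)
    then obtain i where "i \<in> {0..n}" "f i = u" by blast
    then show "f (p u) = u" "p u \<in> {0..n}" using p(2) by auto
  qed
  have "bij_betw p {0..n} {0..n}"
    using p(2) fp bij by (intro bij_betw_byWitness[where f' = f]) (auto simp: bij_betw_def)
  have edge: "u \<in> {1..n} \<and> v \<in> {0..n}" if "(u, v) \<in> T" for u v
    using T that by (auto simp: directed_tree_def)
  have step: "p v < p u \<and> (\<forall>u' v'. (u', v') \<in> T \<longrightarrow> p v' < p u \<longrightarrow> p u \<le> p u' \<longrightarrow>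
      (p v', u') \<le> (p v, u))" if uv: "(u, v) \<in> T" for u v
  proof -
    have u: "u \<in> {1..n}" "u \<in> {0..n}" using edge[OF uv] by auto
    have "p u \<noteq> 0"
    proof
      assume "p u = 0"
      then have "f 0 = u" using fp(1)[OF u(2)] by simp
      then show False using u(1) f by (simp add: depth_first_def)
    qed
    then obtain i where i: "p u = Suc i" by (cases "p u") auto
    then have "i < n" "f (Suc i) = u" using fp[OF u(2)] by auto
    then obtain k where k: "(k, u) \<in> traversal_steps n T f i"
      "\<And>q. q \<in> traversal_steps n T f i \<Longrightarrow> q \<le> (k, u)"
      using depth_first_step[OF f \<open>i < n\<close>] by metis
    then have "k \<le> i" "(u, f k) \<in> T" by (auto simp: traversal_steps_def)
    then have "f k = v" using T uv by (auto simp: directed_tree_def single_valued_def)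
    then have pv: "p v = k" using p(2)[of k] \<open>k \<le> i\<close> \<open>i < n\<close> by auto
    have "(p v', u') \<le> (p v, u)" if e: "(u', v') \<in> T" "p v' < p u" "p u \<le> p u'" for u' v'
    proof -
      have "u' \<notin> f ` {0..i}" using p(2) e(3) i \<open>i < n\<close> by auto
      then have "(p v', u') \<in> traversal_steps n T f i"
        using e i edge[OF e(1)] fp(1)[of v'] by (auto simp: traversal_steps_def)
      then show ?thesis unfolding pv by (rule k(2))
    qed
    then show ?thesis using pv \<open>k \<le> i\<close> i by auto
  qed
  show ?thesis unfolding noncrossing_labelling_def
  proof (intro conjI allI impI notI)
    fix i j k assume a: "(i, k) \<in> T \<and> (j, k) \<in> T \<and> i < j"
    show "p j < p i"
    proof (rule ccontr)
      assume "\<not> p j < p i"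
      then have "(p k, j) \<le> (p k, i)" using a step by (meson not_le)
      then show False using a by simp
    qed
  next
    assume "\<exists>u v u' v'. (u, v) \<in> T \<and> (u', v') \<in> T \<and> p v < p v' \<and> p v' < p u \<and> p u < p u'"
    then obtain u v u' v' where c: "(u, v) \<in> T" "(u', v') \<in> T" "p v < p v'" "p v' < p u" "p u < p u'"
      by blast
    then have "(p v', u') \<le> (p v, u)" using step by (meson less_imp_le)
    then show False using c(3) by simp
  qed (use p \<open>bij_betw p _ _\<close> step in auto)
qed

text \<open>Let \<open>w\<close> be the vertex at position \<open>Suc i\<close>, \<open>v\<close>
  its parent, and \<open>(k, j)\<close> another available pair, so that \<open>j\<close> has a later
  label than \<open>w\<close>. If \<open>k\<close> exceeds \<open>p v\<close>, the edges of
  \<open>w\<close> and \<open>j\<close> cross; if \<open>k = p v\<close> and \<open>j\<close>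
  exceeds \<open>w\<close>, the order of siblings is violated.\<close>

lemma noncrossing_depth_first:
  assumes T: "directed_tree n T" and p: "noncrossing_labelling n T p"
    and f: "\<And>i. i \<in> {0..n} \<Longrightarrow> f i \<in> {0..n} \<and> p (f i) = i"
  shows "depth_first n T n f"
proof -
  have inj: "inj_on p {0..n}" and range: "p u \<in> {0..n}" if "u \<in> {0..n}" for u
    using p that by (auto simp: noncrossing_labelling_def bij_betw_def)
  have less: "p v < p u" if "(u, v) \<in> T" for u v
    using p that unfolding noncrossing_labelling_def by blast
  have sib: "p j < p i" if "(i, k) \<in> T" "(j, k) \<in> T" "i < j" for i j k
    using p that unfolding noncrossing_labelling_def by blast
  have nocross: False
    if "(u, v) \<in> T" "(u', v') \<in> T" "p v < p v'" "p v' < p u" "p u < p u'" for u v u' v'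
    using p that unfolding noncrossing_labelling_def by blast
  have edge: "u \<in> {1..n} \<and> v \<in> {0..n}" if "(u, v) \<in> T" for u v
    using T that by (auto simp: directed_tree_def)
  have out: "\<exists>v. (u, v) \<in> T" if "u \<in> {1..n}" for u
    using T that by (auto simp: directed_tree_def)
  have fp: "f (p u) = u" if "u \<in> {0..n}" for u
    using f[OF range[OF that]] that inj by (auto simp: inj_on_def)
  have f0: "f 0 = 0"
  proof (rule ccontr)
    assume "f 0 \<noteq> 0"
    then obtain v where "(f 0, v) \<in> T" using f[of 0] out[of "f 0"] by auto
    then show False using less f[of 0] by fastforce
  qed
  show ?thesis unfolding depth_first_def
  proof (intro conjI allI impI)
    show "f 0 = 0" by (rule f0)
    fix i assume i: "i < n"
    let ?w = "f (Suc i)"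
    have w: "?w \<in> {0..n}" "p ?w = Suc i" using f[of "Suc i"] i by auto
    have "p 0 = 0" using f[of 0] f0 by simp
    then have "?w \<noteq> 0" using w by (metis nat.distinct(1))
    then obtain v where v: "(?w, v) \<in> T" using out[of ?w] w by auto
    have k: "(p v, ?w) \<in> traversal_steps n T f i"
    proof -
      have "?w \<notin> f ` {0..i}"
      proof
        assume "?w \<in> f ` {0..i}"
        then obtain x where "x \<le> i" "?w = f x" by auto
        then show False using f[of x] w(2) i by auto
      qed
      then show ?thesis
        using v less[OF v] edge[OF v] w fp[of v] by (auto simp: traversal_steps_def)
    qed
    have max: "q \<le> (p v, ?w)" if "q \<in> traversal_steps n T f i" for q
    proof -
      obtain k j where q: "q = (k, j)" "k \<le> i" "j \<in> {1..n}" "j \<notin> f ` {0..i}" "(j, f k) \<in> T"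
        using \<open>q \<in> _\<close> by (auto simp: traversal_steps_def)
      have pk: "p (f k) = k" using f[of k] q(2) i by auto
      have "\<not> p j \<le> i" using q(3,4) fp[of j] by force
      moreover have "j = ?w" if "p j = Suc i" using fp[of j] q(3) that by simp
      ultimately consider "j = ?w" | "p j > Suc i" by linarith
      then show ?thesis
      proof cases
        case 1
        then have "f k = v" using T q(5) v by (auto simp: directed_tree_def single_valued_def)
        then show ?thesis using 1 q(1) pk by auto
      next
        case 2
        have "k \<le> p v"
          using nocross[OF v q(5)] 2 w q(2) pk by (metis le_imp_less_Suc not_le)
        moreover have "j \<le> ?w" if "k = p v"
        proof (rule ccontr)
          assume "\<not> j \<le> ?w"
          moreover have "f k = v" using that fp[of v] edge[OF v] by simp
          ultimately show False using sib[of ?w v j] v q(5) 2 w by simp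
        qed
        ultimately show ?thesis using q(1) by (cases "k = p v") auto
      qed
    qed
    show "traversal_steps n T f i \<noteq> {}" "?w = snd (Max (traversal_steps n T f i))"
      using depth_first_SucI[OF k max] by auto
  qed
qed

text \<open>The inverses of both labellings are depth-first traversals, whose values are determined
  one after the other.\<close>

lemma noncrossing_labelling_unique:
  assumes T: "directed_tree n T" and p: "noncrossing_labelling n T p" "noncrossing_labelling n T q"
  shows "p = q"
proof (rule extensionalityI[of _ "{0..n}"])
  show "p \<in> extensional {0..n}" "q \<in> extensional {0..n}"
    using p by (auto simp: noncrossing_labelling_def)
  have inv: "inv_into {0..n} p i \<in> {0..n} \<and> p (inv_into {0..n} p i) = i"
    if "noncrossing_labelling n T p" "i \<in> {0..n}" for p i
  proof -
    have "i \<in> p ` {0..n}" using that by (simp add: noncrossing_labelling_def bij_betw_def)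
    then show ?thesis by (meson inv_into_into f_inv_into_f)
  qed
  have eq: "inv_into {0..n} p i = inv_into {0..n} q i" if "i \<in> {0..n}" for i
    using depth_first_unique[OF noncrossing_depth_first[OF T p(1) inv[OF p(1)]]
        noncrossing_depth_first[OF T p(2) inv[OF p(2)]]] that by auto
  fix u assume u: "u \<in> {0..n}"
  then have "p u \<in> {0..n}" "inv_into {0..n} p (p u) = u"
    using p(1) by (auto simp: noncrossing_labelling_def bij_betw_def)
  then show "p u = q u" using eq[of "p u"] inv[OF p(2), of "p u"] by auto
qed

lemma noncrossing_labelling_exists:
  assumes "directed_tree n T"
  shows "\<exists>p. noncrossing_labelling n T p"
proof -
  obtain f where f: "depth_first n T n f" using depth_first_exists[OF assms order_refl] by blast
  have "bij_betw f {0..n} {0..n}" by (rule depth_first_bij[OF f])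
  then have "noncrossing_labelling n T (restrict (inv_into {0..n} f) {0..n})"
    by (intro depth_first_noncrossing[OF assms f]) (auto simp: bij_betw_def)
  then show ?thesis by blast
qed

subsection \<open>The candidates of the construction\<close>

text \<open>In a strictly increasing list the index of an entry is the number of smaller entries.
  This turns \<open>k = l ! a j\<close> into a count of the kind used in
  \<open>exponent_of_tree\<close>.\<close>

lemma nth_sorted_list_of_set_iff:
  fixes A :: "nat set"
  assumes "finite A"
  shows "m < length (sorted_list_of_set A) \<and> k = sorted_list_of_set A ! m \<longleftrightarrow>
    k \<in> A \<and> card {x \<in> A. x < k} = m"
proof -
  let ?l = "sorted_list_of_set A"
  have len: "length ?l = card A" and set: "set ?l = A" and sorted: "sorted_wrt (<) ?l"
    using assms by auto
  have mono: "?l ! i < ?l ! j \<longleftrightarrow> i < j" if "i < card A" "j < card A" for i j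
    using that sorted len by (metis linorder_neqE_nat order_less_asym' sorted_wrt_nth_less)
  have card: "card {x \<in> A. x < ?l ! i} = i" if i: "i < card A" for i
  proof -
    have "{x \<in> A. x < ?l ! i} = (!) ?l ` {..<i}"
    proof (intro equalityI subsetI)
      fix x assume "x \<in> {x \<in> A. x < ?l ! i}"
      then have x: "x \<in> set ?l" "x < ?l ! i" using set by auto
      then obtain j where "j < card A" "x = ?l ! j" using len by (metis in_set_conv_nth)
      then show "x \<in> (!) ?l ` {..<i}" using x(2) mono[of j i] i by auto
    next
      fix x assume "x \<in> (!) ?l ` {..<i}"
      then obtain j where "j < i" "x = ?l ! j" by auto
      then show "x \<in> {x \<in> A. x < ?l ! i}"
        using mono[of j i] i len set nth_mem[of j ?l] by auto
    qed
    moreover have "inj_on ((!) ?l) {..<i}"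
      using i len by (intro inj_on_nth) auto
    ultimately show ?thesis by (simp add: card_image)
  qed
  show ?thesis
  proof
    assume "m < length ?l \<and> k = ?l ! m"
    then show "k \<in> A \<and> card {x \<in> A. x < k} = m" using card[of m] len set nth_mem[of m ?l] by auto
  next
    assume k: "k \<in> A \<and> card {x \<in> A. x < k} = m"
    then obtain i where "i < card A" "k = ?l ! i" using set len by (metis in_set_conv_nth)
    then show "m < length ?l \<and> k = ?l ! m" using card[of i] k len by auto
  qed
qed

text \<open>The condition on \<open>(k, j)\<close> does not involve \<open>i\<close>: once a vertex is a candidate, it remains so
  with the same \<open>k\<close> until it is chosen.\<close>

lemma candidates_eq:
  "candidates n E a f {0..i} = {(k, j). k \<in> {0..i} \<and> j \<in> {1..n} - f ` {0..i} \<and>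
     f k \<in> coned_nbrs n E j \<and> card {k'. k' < k \<and> f k' \<in> coned_nbrs n E j} = a j}"
proof -
  have "(let l = sorted_list_of_set {k' \<in> {0..i}. f k' \<in> coned_nbrs n E j}
         in a j < length l \<and> k = l ! a j) \<longleftrightarrow>
     f k \<in> coned_nbrs n E j \<and> card {k'. k' < k \<and> f k' \<in> coned_nbrs n E j} = a j"
    if "k \<in> {0..i}" for k j
  proof -
    have "{x \<in> {k' \<in> {0..i}. f k' \<in> coned_nbrs n E j}. x < k} =
      {k'. k' < k \<and> f k' \<in> coned_nbrs n E j}" using that by auto
    then show ?thesis
      using that nth_sorted_list_of_set_iff[of "{k' \<in> {0..i}. f k' \<in> coned_nbrs n E j}" "a j" k]
      by (simp add: Let_def)
  qed
  then show ?thesis unfolding candidates_def by blast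
qed

lemma finite_candidates: "finite (candidates n E a f {0..i})"
  by (rule finite_subset[of _ "{0..i} \<times> {1..n}"]) (auto simp: candidates_def)

lemma candidates_cong:
  assumes "\<And>k. k \<le> i \<Longrightarrow> f k = g k"
  shows "candidates n E a f {0..i} = candidates n E a g {0..i}"
proof -
  have "f ` {0..i} = g ` {0..i}" using assms by (intro image_cong) auto
  moreover have "{k' \<in> {0..i}. f k' \<in> X} = {k' \<in> {0..i}. g k' \<in> X}" for X using assms by auto
  ultimately show ?thesis by (simp add: candidates_def)
qed

text \<open>The count grows strictly from one position in \<open>N\<close> to the next, because the
  earlier position is itself counted at the later one. Hence a vertex can be attached at one
  position only, whatever the stage.\<close>

lemma attachment_unique:
  fixes k k' :: nat
  assumes "f k \<in> N" "f k' \<in> N" "card {x. x < k \<and> f x \<in> N} = card {x. x < k' \<and> f x \<in> N}"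
  shows "k = k'"
proof -
  have "card {x. x < k \<and> f x \<in> N} < card {x. x < k' \<and> f x \<in> N}"
    if "k < k'" "f k \<in> N" for k k'
  proof (rule psubset_card_mono)
    show "{x. x < k \<and> f x \<in> N} \<subset> {x. x < k' \<and> f x \<in> N}"
    proof (rule psubsetI)
      have "k \<in> {x. x < k' \<and> f x \<in> N}" "k \<notin> {x. x < k \<and> f x \<in> N}" using that by auto
      then show "{x. x < k \<and> f x \<in> N} \<noteq> {x. x < k' \<and> f x \<in> N}" by metis
    qed (use that in auto)
  qed auto
  from this[of k k'] this[of k' k] show ?thesis
    using assms by (cases k k' rule: linorder_cases) simp_all
qed

section \<open>Neighbours in the coned graph and out-degrees\<close>

lemma coned_nbrs_subset:
  assumes "simple_graph n E"
  shows "coned_nbrs n E j \<subseteq> {0..n}" "finite (coned_nbrs n E j)"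
proof -
  show sub: "coned_nbrs n E j \<subseteq> {0..n}"
    using edge_in_coned_edges[OF assms] by (auto simp: coned_nbrs_def)
  show "finite (coned_nbrs n E j)" using finite_subset[OF sub] by simp
qed

text \<open>The root is adjacent to \<open>j\<close> and never in \<sigma>; it accounts for the
  \<open>Suc\<close>.\<close>

lemma out_degree_eq:
  assumes G: "simple_graph n E" and \<sigma>: "\<sigma> \<subseteq> {1..n}" "j \<in> \<sigma>"
  shows "Suc (out_degree n E \<sigma> j) = card (coned_nbrs n E j - \<sigma>)"
proof -
  have j: "j \<in> {1..n}" "j \<noteq> 0" using \<sigma> by auto
  have root: "0 \<in> coned_nbrs n E j - \<sigma>"
    using j \<sigma>(1) by (auto simp: coned_nbrs_def coned_edges_def insert_commute)
  have "u \<in> coned_nbrs n E j \<longleftrightarrow> u \<in> {1..n} \<and> {j, u} \<in> E" if "u \<noteq> 0" for u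
  proof
    assume "u \<in> coned_nbrs n E j"
    then have "{j, u} \<in> coned_edges n E" by (simp add: coned_nbrs_def)
    then show "u \<in> {1..n} \<and> {j, u} \<in> E" using edge_in_coned_edges[OF G] that j by fastforce
  qed (simp add: coned_nbrs_def coned_edges_def)
  then have "coned_nbrs n E j - \<sigma> = insert 0 {u \<in> {1..n}. u \<notin> \<sigma> \<and> {j, u} \<in> E}"
    using root by fastforce
  then show ?thesis by (simp add: out_degree_def)
qed

text \<open>Without candidates, every unvisited \<open>j\<close> has at most \<open>a j\<close> visited neighbours, so any connected
  component of the unvisited vertices gives a generator dividing the monomial.\<close>

lemma candidates_nonempty:
  assumes G: "simple_graph n E" and a: "\<not> generator_divides n E a"
    and f: "f ` {0..i} \<subseteq> {0..n}" "0 \<in> f ` {0..i}" and "i < n"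
  shows "candidates n E a f {0..i} \<noteq> {}"
proof
  assume empty: "candidates n E a f {0..i} = {}"
  define U where "U = {1..n} - f ` {0..i}"
  have large: "card (coned_nbrs n E j - U) \<le> a j" if j: "j \<in> U" for j
  proof (rule ccontr)
    let ?K = "{k' \<in> {0..i}. f k' \<in> coned_nbrs n E j}"
    let ?k = "sorted_list_of_set ?K ! a j"
    assume "\<not> card (coned_nbrs n E j - U) \<le> a j"
    \<comment> \<open>The neighbours outside \<open>U\<close> are the visited ones, the root
      included. If there are more than \<open>a j\<close> of them, the list in
      \<open>candidates\<close> has an entry at index \<open>a j\<close>.\<close>
    moreover have "coned_nbrs n E j - U = f ` ?K"
      using coned_nbrs_subset(1)[OF G, of j] f(1,2) by (force simp: U_def Suc_le_eq)
    ultimately have lt: "a j < card ?K"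
      using card_image_le[of ?K f] by simp
    then have "?k \<in> set (sorted_list_of_set ?K)" by (intro nth_mem) simp
    then have "?k \<in> {0..i}" by simp
    then have "(?k, j) \<in> candidates n E a f {0..i}"
      using lt j by (simp add: candidates_def U_def)
    then show False using empty by blast
  qed
  have "card (f ` {0..i}) \<le> i + 1" using card_image_le[of "{0..i}" f] by simp
  then have "\<not> {0..n} \<subseteq> f ` {0..i}" using \<open>i < n\<close> card_mono[of "f ` {0..i}" "{0..n}"] by auto
  then obtain u where "u \<in> {0..n}" "u \<notin> f ` {0..i}" by blast
  then have u: "u \<in> U" using f(2) by (cases "u = 0") (auto simp: U_def)
  let ?R = "{(x, y). x \<in> U \<and> y \<in> U \<and> {x, y} \<in> E}"
  define \<sigma> where "\<sigma> = {v. (u, v) \<in> ?R\<^sup>*}"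
  have \<sigma>U: "\<sigma> \<subseteq> U"
  proof
    fix v assume "v \<in> \<sigma>"
    then show "v \<in> U" unfolding \<sigma>_def using u by (auto elim: rtranclE)
  qed
  then have \<sigma>: "\<sigma> \<subseteq> {1..n}" by (auto simp: U_def)
  have "u \<in> \<sigma>" by (simp add: \<sigma>_def)
  have closed: "y \<in> \<sigma>" if "x \<in> \<sigma>" "y \<in> U" "{x, y} \<in> E" for x y
  proof -
    have "(x, y) \<in> ?R" using that \<sigma>U by auto
    then show ?thesis using that(1) unfolding \<sigma>_def by (auto intro: rtrancl_into_rtrancl)
  qed
  \<comment> \<open>\<open>connected_graph\<close> asks for paths within \<sigma>, not just within
    \<open>U\<close>; paths in \<open>U\<close> from \<open>u\<close> never leave \<sigma>, so the
    two agree.\<close>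
  let ?S = "{(x, y). x \<in> \<sigma> \<and> y \<in> \<sigma> \<and> {x, y} \<in> E}"
  have "(u, v) \<in> ?S\<^sup>*" if "v \<in> \<sigma>" for v
  proof -
    have "(u, v) \<in> ?R\<^sup>*" using that by (simp add: \<sigma>_def)
    then show ?thesis
    proof (induction rule: rtrancl_induct)
      case (step y z)
      then have "y \<in> \<sigma>" "z \<in> \<sigma>" by (auto simp: \<sigma>_def intro: rtrancl_into_rtrancl)
      then show ?case using step by (auto intro: rtrancl_into_rtrancl)
    qed auto
  qed
  moreover have "sym (?S\<^sup>*)" by (intro sym_rtrancl) (auto simp: sym_def insert_commute)
  ultimately have "connected_graph \<sigma> E"
    unfolding connected_graph_def linked_within_def by (meson rtrancl_trans symD)
  moreover have "out_degree n E \<sigma> j < a j" if j: "j \<in> \<sigma>" for j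
  proof -
    have "u \<in> \<sigma>" if "u \<in> U" "u \<in> coned_nbrs n E j" for u
    proof (rule closed[OF j \<open>u \<in> U\<close>])
      have "u \<noteq> 0" "j \<noteq> 0" using that(1) j \<sigma>U by (auto simp: U_def)
      then show "{j, u} \<in> E"
        using that(2) edge_in_coned_edges(4)[OF G, of j u] by (simp add: coned_nbrs_def)
    qed
    \<comment> \<open>As a component, \<sigma> contains all neighbours of \<open>j\<close> in
      \<open>U\<close>; those outside \<sigma> are therefore visited, and \<open>large\<close>
      bounds their number.\<close>
    then have "coned_nbrs n E j - \<sigma> = coned_nbrs n E j - U" using \<sigma>U by auto
    then show ?thesis
      using out_degree_eq[OF G \<sigma> j] large[of j] j \<sigma>U by auto
  qed
  ultimately show False using a \<open>u \<in> \<sigma>\<close> \<sigma> unfolding generator_divides_def by blast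
qed

subsection \<open>The two constructions are mutually inverse\<close>

lemma exponent_of_tree_apply:
  assumes T: "directed_tree n T" and p: "noncrossing_labelling n T p"
    and "(i, v) \<in> T"
  shows "exponent_of_tree n E T i = card {j \<in> coned_nbrs n E i. p j < p v}"
proof -
  have "(THE p. noncrossing_labelling n T p) = p"
    using noncrossing_labelling_unique[OF T] p by blast
  moreover have "(THE v. (i, v) \<in> T) = v"
    using T assms(3) by (auto simp: directed_tree_def single_valued_def)
  moreover have "i \<in> {1..n}" using T assms(3) by (auto simp: directed_tree_def)
  ultimately show ?thesis by (simp add: exponent_of_tree_def)
qed

text \<open>Take \<open>i\<close> in \<sigma> with the least label. Its parent and everything before
  the parent lie outside \<sigma>. The exponent counts the neighbours before the parent but not the
  parent, so it stays below the number of neighbours outside \<sigma> and does not exceed the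
  out-degree.\<close>

lemma exponent_of_tree_not_generator_divides:
  assumes G: "simple_graph n E" and T: "T \<in> rooted_spanning_trees n E"
  shows "\<not> generator_divides n E (exponent_of_tree n E T)"
proof
  assume "generator_divides n E (exponent_of_tree n E T)"
  then obtain \<sigma> where \<sigma>: "\<sigma> \<subseteq> {1..n}" "\<sigma> \<noteq> {}"
    "\<And>i. i \<in> \<sigma> \<Longrightarrow> out_degree n E \<sigma> i < exponent_of_tree n E T i"
    by (auto simp: generator_divides_def)
  have tree: "directed_tree n T" and und: "underlying T \<subseteq> coned_edges n E"
    using T rooted_spanning_trees_iff[OF G] by auto
  obtain p where p: "noncrossing_labelling n T p"
    using noncrossing_labelling_exists[OF tree] by blast
  have "\<exists>i. i \<in> \<sigma> \<and> (\<forall>j. j \<in> \<sigma> \<longrightarrow> p i \<le> p j)"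
    using \<sigma>(2) ex_has_least_nat[of "\<lambda>i. i \<in> \<sigma>" _ p] by blast
  then obtain i where i: "i \<in> \<sigma>" and least: "\<And>j. j \<in> \<sigma> \<Longrightarrow> p i \<le> p j" by blast
  have "i \<in> Domain T" using i \<sigma>(1) tree by (auto simp: directed_tree_def)
  then obtain v where v: "(i, v) \<in> T" by blast
  have pv: "p v < p i" using p v unfolding noncrossing_labelling_def by blast
  have fin: "finite (coned_nbrs n E i)" by (rule coned_nbrs_subset(2)[OF G])
  have "v \<in> coned_nbrs n E i" using underlyingI(1)[OF v] und by (auto simp: coned_nbrs_def)
  moreover have "v \<notin> \<sigma>" using least[of v] pv by auto
  ultimately have "{j \<in> coned_nbrs n E i. p j < p v} \<subset> coned_nbrs n E i - \<sigma>"
    using least pv by (fastforce simp: psubset_eq)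
  then have "card {j \<in> coned_nbrs n E i. p j < p v} < card (coned_nbrs n E i - \<sigma>)"
    using fin by (intro psubset_card_mono) auto
  then show False
    using exponent_of_tree_apply[OF tree p v, of E] \<sigma>(3)[OF i] out_degree_eq[OF G \<sigma>(1) i] by simp
qed

text \<open>By \<open>attachment_unique\<close>, the only position at which \<open>j\<close> meets
  the candidate condition for the exponent of \<open>T\<close> is that of its parent in
  \<open>T\<close>. So candidates and traversal steps agree, and the two maxima select the same
  vertex and edge.\<close>

lemma tree_of_exponent_of_tree:
  assumes G: "simple_graph n E" and T: "T \<in> rooted_spanning_trees n E"
  shows "tree_of_exponent n E (exponent_of_tree n E T) = T"
proof -
  let ?b = "exponent_of_tree n E T"
  have tree: "directed_tree n T" and und: "underlying T \<subseteq> coned_edges n E"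
    using T rooted_spanning_trees_iff[OF G] by auto
  obtain p where p: "noncrossing_labelling n T p"
    using noncrossing_labelling_exists[OF tree] by blast
  define f where "f = inv_into {0..n} p"
  have bij: "bij_betw p {0..n} {0..n}" using p by (simp add: noncrossing_labelling_def)
  have f: "f i \<in> {0..n} \<and> p (f i) = i" if "i \<in> {0..n}" for i
  proof -
    have "i \<in> p ` {0..n}" using bij that by (simp add: bij_betw_def)
    then show ?thesis unfolding f_def by (meson inv_into_into f_inv_into_f)
  qed
  have fp: "f (p u) = u" "p u \<in> {0..n}" if "u \<in> {0..n}" for u
    using bij that by (auto simp: bij_betw_def f_def)
  have df: "depth_first n T n f" by (rule noncrossing_depth_first[OF tree p f])
  have edge: "u \<in> {1..n}" "v \<in> {0..n}" "v \<in> coned_nbrs n E u" if "(u, v) \<in> T" for u v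
    using tree that underlyingI(1)[OF that] und
    by (auto simp: directed_tree_def coned_nbrs_def)
  \<comment> \<open>The labelling carries the neighbours counted by the exponent to the positions
    counted in \<open>candidates_eq\<close>.\<close>
  have exponent: "card {k'. k' < p v \<and> f k' \<in> coned_nbrs n E j} = ?b j" if jv: "(j, v) \<in> T" for j v
  proof -
    have nbr: "u \<in> {0..n}" if "u \<in> coned_nbrs n E j" for u
      using coned_nbrs_subset(1)[OF G] that by blast
    have pf: "p (f k') = k'" if "k' < p v" for k'
      using f[of k'] that fp(2)[OF edge(2)[OF jv]] by simp
    have "bij_betw p {u \<in> coned_nbrs n E j. p u < p v} {k'. k' < p v \<and> f k' \<in> coned_nbrs n E j}"
    proof (rule bij_betw_byWitness[where f' = f])
      show "p ` {u \<in> coned_nbrs n E j. p u < p v} \<subseteq> {k'. k' < p v \<and> f k' \<in> coned_nbrs n E j}"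
        using nbr fp(1) by auto
      show "f ` {k'. k' < p v \<and> f k' \<in> coned_nbrs n E j} \<subseteq> {u \<in> coned_nbrs n E j. p u < p v}"
        using pf by auto
      show "\<forall>u\<in>{u \<in> coned_nbrs n E j. p u < p v}. f (p u) = u"
        using nbr fp(1) by auto
      show "\<forall>k'\<in>{k'. k' < p v \<and> f k' \<in> coned_nbrs n E j}. p (f k') = k'"
        using pf by auto
    qed
    then show ?thesis
      using exponent_of_tree_apply[OF tree p jv, of E] by (simp add: bij_betw_same_card)
  qed
  have candidates: "candidates n E ?b f {0..i} = traversal_steps n T f i" if "i < n" for i
  proof -
    have "f k \<in> coned_nbrs n E j \<and> card {k'. k' < k \<and> f k' \<in> coned_nbrs n E j} = ?b j \<longleftrightarrow> (j, f k) \<in> T"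
      if "k \<in> {0..i}" "j \<in> {1..n}" for k j
    proof
      assume k: "f k \<in> coned_nbrs n E j \<and> card {k'. k' < k \<and> f k' \<in> coned_nbrs n E j} = ?b j"
      have "j \<in> Domain T" using that(2) tree by (simp add: directed_tree_def)
      then obtain v where v: "(j, v) \<in> T" by blast
      have "f (p v) \<in> coned_nbrs n E j" using fp(1)[OF edge(2)[OF v]] edge(3)[OF v] by simp
      then have "k = p v"
        using k exponent[OF v] attachment_unique[of f k "coned_nbrs n E j" "p v"] by simp
      then show "(j, f k) \<in> T" using v fp(1)[OF edge(2)[OF v]] by simp
    next
      assume e: "(j, f k) \<in> T"
      have "p (f k) = k" using f that(1) \<open>i < n\<close> by simp
      then show "f k \<in> coned_nbrs n E j \<and> card {k'. k' < k \<and> f k' \<in> coned_nbrs n E j} = ?b j"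
        using exponent[OF e] edge(3)[OF e] by simp
    qed
    then show ?thesis unfolding candidates_eq traversal_steps_def by blast
  qed
  \<comment> \<open>Agreement with \<open>f\<close> holds up to position \<open>i\<close> only,
    later values being the initial default; \<open>candidates\<close> with \<open>{0..i}\<close>
    looks at no others.\<close>
  have state: "(\<forall>k\<le>i. fst (tree_state n E ?b i) k = f k) \<and>
      snd (tree_state n E ?b i) = {(u, v) \<in> T. p u \<le> i}" if "i \<le> n" for i
    using that
  proof (induction i)
    case 0
    have "\<not> p u \<le> 0" if "(u, v) \<in> T" for u v
      using p that unfolding noncrossing_labelling_def by (metis not_less_zero le_zero_eq)
    then show ?case using df by (auto simp: depth_first_def)
  next
    case (Suc i)
    obtain g S where gS: "tree_state n E ?b i = (g, S)" by fastforce
    have g: "\<And>k. k \<le> i \<Longrightarrow> g k = f k" and S: "S = {(u, v) \<in> T. p u \<le> i}"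
      using Suc gS by auto
    let ?M = "Max (traversal_steps n T f i)"
    have cand: "candidates n E ?b g {0..i} = traversal_steps n T f i"
      using candidates_cong[of i g f] g candidates Suc.prems by simp
    have "?M \<in> traversal_steps n T f i" "f (Suc i) = snd ?M"
      using df Suc.prems Max_in[OF finite_traversal_steps] by (auto simp: depth_first_def)
    then obtain k where k: "?M = (k, f (Suc i))" "k \<le> i" "(f (Suc i), f k) \<in> T"
      by (cases ?M) (auto simp: traversal_steps_def)
    have eq: "tree_state n E ?b (Suc i) = (g(Suc i := f (Suc i)), insert (f (Suc i), f k) S)"
      using gS cand k g by simp
    have "{(u, v) \<in> T. p u \<le> Suc i} = insert (f (Suc i), f k) {(u, v) \<in> T. p u \<le> i}"
    proof (intro equalityI subsetI)
      fix e assume "e \<in> {(u, v) \<in> T. p u \<le> Suc i}"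
      then obtain u v where e: "e = (u, v)" "(u, v) \<in> T" "p u \<le> Suc i" by blast
      show "e \<in> insert (f (Suc i), f k) {(u, v) \<in> T. p u \<le> i}"
      proof (cases "p u \<le> i")
        case False
        then have "p u = Suc i" using e by simp
        then have "u = f (Suc i)" using fp(1)[of u] edge(1)[OF e(2)] by simp
        then have "v = f k" using tree e(2) k(3) by (auto simp: directed_tree_def single_valued_def)
        then show ?thesis using e \<open>u = f (Suc i)\<close> by simp
      qed (use e in auto)
    next
      fix e assume "e \<in> insert (f (Suc i), f k) {(u, v) \<in> T. p u \<le> i}"
      then show "e \<in> {(u, v) \<in> T. p u \<le> Suc i}" using k(3) f[of "Suc i"] Suc.prems by auto
    qed
    then show ?case using eq g S by (simp add: le_Suc_eq)
  qed
  have "p u \<le> n" if "(u, v) \<in> T" for u v using fp(2)[of u] edge(1)[OF that] by auto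
  then show ?thesis using state[of n] unfolding tree_of_exponent_def by auto
qed

text \<open>Each step writes to its new position only, so the function of the final state can stand
  for the functions of all earlier ones.\<close>

lemma tree_state_final:
  assumes "i \<le> m" "k \<le> i"
  shows "fst (tree_state n E a m) k = fst (tree_state n E a i) k"
  using assms
proof (induction m rule: dec_induct)
  case (step m)
  then show ?case by (simp add: case_prod_unfold Let_def)
qed simp

text \<open>Once the tree is complete, the candidates at each stage are its traversal steps. So
  \<open>f\<close> is its depth-first traversal, the inverse of \<open>f\<close> is its labelling,
  and the count in the candidate condition is its exponent. Equality is claimed on
  \<open>{1..n}\<close> because \<open>a\<close> may be anything elsewhere.\<close>

lemma tree_of_exponent:
  assumes G: "simple_graph n E" and a: "\<not> generator_divides n E a"
  shows "tree_of_exponent n E a \<in> rooted_spanning_trees n E" (is ?tree)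
    and "\<forall>i\<in>{1..n}. exponent_of_tree n E (tree_of_exponent n E a) i = a i" (is ?exponent)
proof -
  define T where "T = tree_of_exponent n E a"
  define f where "f = fst (tree_state n E a n)"
  \<comment> \<open>The position of the parent of \<open>f (Suc i)\<close>: the index is that of the
    last filled position, one less than that of the new vertex.\<close>
  define \<kappa> where "\<kappa> = (\<lambda>i. fst (Max (candidates n E a f {0..i})))"
  have f_state: "fst (tree_state n E a i) k = f k" if "k \<le> i" "i \<le> n" for i k
    using tree_state_final[OF that(2,1)] by (simp add: f_def)
  have f0: "f 0 = 0" using f_state[of 0 0] by simp
  have cand: "candidates n E a (fst (tree_state n E a i)) {0..i} = candidates n E a f {0..i}"
    if "i \<le> n" for i
    using f_state that by (intro candidates_cong) auto
  have fSuc: "f (Suc i) = snd (Max (candidates n E a f {0..i}))" if "i < n" for i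
    using f_state[of "Suc i" "Suc i"] cand[of i] that by (simp add: case_prod_unfold Let_def)
  have edges: "snd (tree_state n E a m) = (\<lambda>i. (f (Suc i), f (\<kappa> i))) ` {..<m}"
    if "m \<le> n" "\<And>i. i < m \<Longrightarrow> candidates n E a f {0..i} \<noteq> {}" for m
    using that
  proof (induction m)
    case (Suc m)
    have "Max (candidates n E a f {0..m}) \<in> candidates n E a f {0..m}"
      using Suc.prems by (intro Max_in finite_candidates) auto
    then have "\<kappa> m \<le> m" by (auto simp: \<kappa>_def candidates_def)
    then have "fst (tree_state n E a m) (\<kappa> m) = f (\<kappa> m)" using f_state Suc.prems by simp
    then show ?case using Suc fSuc[of m] cand[of m]
      by (simp add: case_prod_unfold Let_def lessThan_Suc \<kappa>_def)
  qed simp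
  \<comment> \<open>The two claims need each other: a candidate at one stage makes the next value of
    \<open>f\<close> a vertex, and values within the vertex set are required to find a candidate at
    the next stage.\<close>
  have ne: "candidates n E a f {0..i} \<noteq> {} \<and> f ` {0..i} \<subseteq> {0..n}" if "i < n" for i
    using that
  proof (induction i)
    case 0
    then show ?case using candidates_nonempty[OF G a, of f 0] f0 by auto
  next
    case (Suc i)
    then have "Max (candidates n E a f {0..i}) \<in> candidates n E a f {0..i}"
      by (intro Max_in finite_candidates) auto
    then have "f (Suc i) \<in> {0..n}" using fSuc[of i] Suc.prems by (auto simp: candidates_def)
    moreover have "f ` {0..i} \<subseteq> {0..n}" using Suc by simp
    ultimately have "f ` {0..Suc i} \<subseteq> {0..n}" by (simp add: atLeast0_atMost_Suc)
    moreover have "0 \<in> f ` {0..Suc i}" using f0 by force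
    ultimately show ?case using candidates_nonempty[OF G a] Suc.prems by blast
  qed
  have T: "T = (\<lambda>i. (f (Suc i), f (\<kappa> i))) ` {..<n}"
    using edges[of n] ne by (simp add: T_def tree_of_exponent_def)
  have max: "(\<kappa> i, f (Suc i)) = Max (candidates n E a f {0..i})"
      "(\<kappa> i, f (Suc i)) \<in> candidates n E a f {0..i}" if "i < n" for i
  proof -
    show "(\<kappa> i, f (Suc i)) = Max (candidates n E a f {0..i})"
      using fSuc[OF that] by (simp add: \<kappa>_def)
    then show "(\<kappa> i, f (Suc i)) \<in> candidates n E a f {0..i}"
      using ne[OF that] by (simp add: finite_candidates)
  qed
  have step: "\<kappa> i \<le> i" "f (Suc i) \<in> {1..n}" "f (Suc i) \<notin> f ` {0..i}"
    "f (\<kappa> i) \<in> coned_nbrs n E (f (Suc i))"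
    "card {k'. k' < \<kappa> i \<and> f k' \<in> coned_nbrs n E (f (Suc i))} = a (f (Suc i))" if "i < n" for i
    using max(2)[OF that] unfolding candidates_eq by auto
  have "f i \<noteq> f j" if "i < j" "j \<le> n" for i j
  proof
    assume "f i = f j"
    then have "f (Suc (j - 1)) \<in> f ` {0..j - 1}" using that by (auto intro!: image_eqI[of _ _ i])
    moreover have "j - 1 < n" using that by simp
    ultimately show False using step(3)[of "j - 1"] by blast
  qed
  then have inj: "inj_on f {0..n}" by (metis atLeastAtMost_iff inj_onI nat_neq_iff)
  have range: "f i \<in> {0..n}" if "i \<le> n" for i
    using step(2)[of "i - 1"] that f0 by (cases i) auto
  then have "f ` {0..n} \<subseteq> {0..n}" by (intro image_subsetI) simp
  then have surj: "f ` {0..n} = {0..n}" using inj by (intro endo_inj_surj) simp_all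
  have index: "\<exists>i<n. f (Suc i) = j" if "j \<in> {1..n}" for j
  proof -
    have "j \<in> f ` {0..n}" using that surj by auto
    then obtain m where "m \<le> n" "f m = j" by auto
    moreover have "m \<noteq> 0" using \<open>f m = j\<close> f0 that by (metis atLeastAtMost_iff not_one_le_zero)
    ultimately show ?thesis by (metis Suc_le_lessD not0_implies_Suc)
  qed
  have same_index: "i = i'" if "f (Suc i) = f (Suc i')" "i < n" "i' < n" for i i'
    using inj_onD[OF inj that(1)] that by simp
  have tree: "directed_tree n T"
    unfolding directed_tree_def
  proof (intro conjI ballI)
    show "single_valued T"
    proof (rule single_valuedI)
      fix x y z assume "(x, y) \<in> T" "(x, z) \<in> T"
      then obtain i i' where "i < n" "i' < n" "x = f (Suc i)" "x = f (Suc i')" "y = f (\<kappa> i)" "z = f (\<kappa> i')"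
        unfolding T by blast
      then show "y = z" using same_index[of i i'] by simp
    qed
    show "Domain T = {1..n}"
    proof (intro equalityI subsetI)
      fix j assume "j \<in> {1..n}"
      then obtain i where "i < n" "f (Suc i) = j" using index by blast
      then show "j \<in> Domain T" unfolding T by blast
    qed (use step(2) in \<open>auto simp: T\<close>)
    show "Range T \<subseteq> {0..n}"
    proof
      fix v assume "v \<in> Range T"
      then obtain i where "i < n" "v = f (\<kappa> i)" unfolding T by blast
      then show "v \<in> {0..n}" using range[of "\<kappa> i"] step(1)[of i] by simp
    qed
    have reach: "m \<le> n \<Longrightarrow> (f m, 0) \<in> T\<^sup>*" for m
    proof (induction m rule: less_induct)
      case (less m)
      show ?case
      proof (cases m)
        case 0
        then show ?thesis using f0 by simp
      next
        case (Suc i)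
        then have "(f m, f (\<kappa> i)) \<in> T" using less.prems unfolding T by auto
        moreover have "(f (\<kappa> i), 0) \<in> T\<^sup>*" using less Suc step(1)[of i] by auto
        ultimately show ?thesis by (rule converse_rtrancl_into_rtrancl)
      qed
    qed
    fix u assume "u \<in> {0..n}"
    then have "u \<in> f ` {0..n}" using surj by simp
    then show "(u, 0) \<in> T\<^sup>*" using reach by auto
  qed
  have "underlying T \<subseteq> coned_edges n E"
    using step(4) by (auto simp: underlying_def T coned_nbrs_def)
  then have RST: "T \<in> rooted_spanning_trees n E" using tree rooted_spanning_trees_iff[OF G] by blast
  then show ?tree by (simp add: T_def)
  have candidates: "candidates n E a f {0..i} = traversal_steps n T f i" if "i < n" for i
  proof -
    have "f k \<in> coned_nbrs n E j \<and> card {k'. k' < k \<and> f k' \<in> coned_nbrs n E j} = a j \<longleftrightarrow> (j, f k) \<in> T"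
      if k: "k \<in> {0..i}" and j: "j \<in> {1..n}" for k j
    proof -
      obtain i' where i': "i' < n" "f (Suc i') = j" using index[OF j] by blast
      \<comment> \<open>The position meeting the condition for \<open>j\<close> is unique, so it is
        that of the stage \<open>i'\<close> at which \<open>j\<close> is chosen, even when the stage
        \<open>i\<close> under consideration is earlier.\<close>
      have att: "f k \<in> coned_nbrs n E j \<and> card {k'. k' < k \<and> f k' \<in> coned_nbrs n E j} = a j \<longleftrightarrow> k = \<kappa> i'"
        using step(4,5)[OF i'(1)] attachment_unique[of f k "coned_nbrs n E j" "\<kappa> i'"]
        unfolding i'(2) by metis
      have "(j, f k) \<in> T \<longleftrightarrow> f k = f (\<kappa> i')"
      proof
        assume "(j, f k) \<in> T"
        then obtain m where "m < n" "j = f (Suc m)" "f k = f (\<kappa> m)" unfolding T by blast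
        then show "f k = f (\<kappa> i')" using same_index[of m i'] i' by simp
      next
        assume "f k = f (\<kappa> i')"
        then show "(j, f k) \<in> T" using i' unfolding T by auto
      qed
      also have "\<dots> \<longleftrightarrow> k = \<kappa> i'"
        using inj_on_eq_iff[OF inj, of k "\<kappa> i'"] step(1)[OF i'(1)] i'(1) k \<open>i < n\<close> by auto
      finally show ?thesis using att by blast
    qed
    then show ?thesis unfolding candidates_eq traversal_steps_def by blast
  qed
  have df: "depth_first n T n f"
    using f0 ne fSuc candidates by (simp add: depth_first_def)
  define p where "p = restrict (inv_into {0..n} f) {0..n}"
  have pf: "p (f i) = i" if "i \<in> {0..n}" for i
    using that inj range by (simp add: p_def)
  have p: "noncrossing_labelling n T p"
    by (rule depth_first_noncrossing[OF tree df _ pf]) (simp_all only: p_def restrict_extensional)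
  show ?exponent
  proof
    fix j assume "j \<in> {1..n}"
    then obtain i where i: "i < n" "f (Suc i) = j" using index by blast
    then have e: "(j, f (\<kappa> i)) \<in> T" unfolding T by blast
    have k: "\<kappa> i \<le> n" "p (f (\<kappa> i)) = \<kappa> i" using step(1)[OF i(1)] i(1) pf[of "\<kappa> i"] by auto
    have "bij_betw f {k'. k' < \<kappa> i \<and> f k' \<in> coned_nbrs n E j} {u \<in> coned_nbrs n E j. p u < \<kappa> i}"
    proof (rule bij_betw_imageI)
      show "inj_on f {k'. k' < \<kappa> i \<and> f k' \<in> coned_nbrs n E j}"
        using k by (intro inj_on_subset[OF inj]) auto
      show "f ` {k'. k' < \<kappa> i \<and> f k' \<in> coned_nbrs n E j} = {u \<in> coned_nbrs n E j. p u < \<kappa> i}"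
      proof (intro equalityI subsetI)
        fix u assume u: "u \<in> {u \<in> coned_nbrs n E j. p u < \<kappa> i}"
        then have "u \<in> f ` {0..n}" using surj coned_nbrs_subset(1)[OF G, of j] by blast
        then obtain m where "m \<in> {0..n}" "u = f m" by blast
        then show "u \<in> f ` {k'. k' < \<kappa> i \<and> f k' \<in> coned_nbrs n E j}" using u pf[of m] by auto
      qed (use k pf in auto)
    qed
    then have "card {u \<in> coned_nbrs n E j. p u < \<kappa> i} = a j"
      using step(5)[OF i(1)] i(2) by (simp add: bij_betw_same_card)
    then show "exponent_of_tree n E (tree_of_exponent n E a) j = a j"
      using exponent_of_tree_apply[OF tree p e, of E] k(2) by (simp add: T_def)
  qed
qed

subsection \<open>Rooted spanning forests\<close>

text \<open>The children of the deleted root become the roots of the forest. The set of roots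
  reachable from a vertex does not change along an edge, so it is constant on components; for a root
  it is that root alone.\<close>

lemma forest_of_tree_in_forests:
  assumes G: "simple_graph n E" and T: "T \<in> rooted_spanning_trees n E"
  shows "forest_of_tree T \<in> rooted_spanning_forests n E"
proof -
  define F where "F = {(u, v) \<in> T. v \<noteq> 0}"
  define R where "R = {u. (u, 0) \<in> T}"
  have tree: "directed_tree n T" and und: "underlying T \<subseteq> coned_edges n E"
    using T rooted_spanning_trees_iff[OF G] by auto
  have dom: "u \<in> {1..n}" if "(u, v) \<in> T" for u v
    using tree that by (auto simp: directed_tree_def)
  have sv: "v = w" if "(u, v) \<in> T" "(u, w) \<in> T" for u v w
    using tree that unfolding directed_tree_def by (meson single_valuedD)
  have "F \<subseteq> T" by (auto simp: F_def)
  have "{u, v} \<in> E" if "(u, v) \<in> F" for u v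
    using edge_in_coned_edges(4)[OF G, of u v] underlyingI(1)[of u v T] und dom[of u v] that
    by (auto simp: F_def)
  then have "underlying F \<subseteq> E" by (auto simp: underlying_def)
  moreover have "asym F"
    using T \<open>F \<subseteq> T\<close> unfolding rooted_spanning_trees_def by (auto intro!: asymI dest: asymD)
  moreover have "acyclic_graph (underlying F)"
  proof -
    obtain d :: "nat \<Rightarrow> nat" where "\<And>u v. (u, v) \<in> T \<Longrightarrow> d v < d u"
      using directed_tree_height[OF tree] by blast
    moreover have "single_valued F" using sv \<open>F \<subseteq> T\<close> by (meson single_valuedI subsetD)
    ultimately show ?thesis using \<open>F \<subseteq> T\<close> by (meson acyclic_graph_underlying subsetD)
  qed
  moreover have "R \<subseteq> {1..n}" using dom by (auto simp: R_def)
  moreover have "\<exists>s\<in>R. (u, s) \<in> F\<^sup>*" if "u \<in> {1..n}" for u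
  proof -
    have "(u, 0) \<in> T\<^sup>*" using tree that by (simp add: directed_tree_def)
    then have "u \<noteq> 0 \<longrightarrow> (\<exists>s\<in>R. (u, s) \<in> F\<^sup>*)"
    proof (induction rule: converse_rtrancl_induct)
      case (step x y)
      show ?case
      proof (cases "y = 0")
        case True
        then show ?thesis using step(1) by (auto simp: R_def)
      next
        case False
        then have "(x, y) \<in> F" using step(1) by (simp add: F_def)
        then show ?thesis using step(3) False by (meson converse_rtrancl_into_rtrancl)
      qed
    qed simp
    then show ?thesis using that by simp
  qed
  moreover have "s = s'"
    if s: "s \<in> R" "(u, s) \<in> linked_within {1..n} (underlying F)"
      "s' \<in> R" "(u, s') \<in> linked_within {1..n} (underlying F)" for u s s'
  proof -
    have root: "(r, w) \<notin> F" if "r \<in> R" for r w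
      using that sv by (auto simp: F_def R_def)
    \<comment> \<open>A path from \<open>x\<close> to a forest root cannot be empty, since forest
      roots have no outgoing edge; it starts with the only edge leaving \<open>x\<close> and so
      continues from \<open>y\<close>.\<close>
    have along_edge: "{r \<in> R. (x, r) \<in> F\<^sup>*} = {r \<in> R. (y, r) \<in> F\<^sup>*}" if xy: "(x, y) \<in> F" for x y
    proof (intro equalityI subsetI)
      fix r assume r: "r \<in> {r \<in> R. (x, r) \<in> F\<^sup>*}"
      then have "x \<noteq> r" using root xy by auto
      then obtain y' where "(x, y') \<in> F" "(y', r) \<in> F\<^sup>*" using r by (auto elim: converse_rtranclE)
      then show "r \<in> {r \<in> R. (y, r) \<in> F\<^sup>*}" using sv[of x y y'] xy \<open>F \<subseteq> T\<close> r by auto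
    qed (use xy in \<open>auto intro: converse_rtrancl_into_rtrancl\<close>)
    have linked: "{r \<in> R. (x, r) \<in> F\<^sup>*} = {r \<in> R. (u, r) \<in> F\<^sup>*}"
      if "(u, x) \<in> linked_within {1..n} (underlying F)" for x
      using that unfolding linked_within_def
    proof (induction rule: rtrancl_induct)
      case (step y z)
      then show ?case using underlyingD[of y z F] along_edge[of y z] along_edge[of z y] by auto
    qed simp
    have "{r \<in> R. (s, r) \<in> F\<^sup>*} = {s}" if "s \<in> R" for s
      using that root by (auto elim: converse_rtranclE)
    then show ?thesis using linked[OF s(2)] linked[OF s(4)] s(1,3) by fastforce
  qed
  moreover have "(u, s) \<in> linked_within {1..n} (underlying F)" if "(u, s) \<in> F\<^sup>*" for u s
  proof -
    have "(x, y) \<in> {(u, v). u \<in> {1..n} \<and> v \<in> {1..n} \<and> {u, v} \<in> underlying F}" if "(x, y) \<in> F" for x y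
    proof -
      have "y \<in> {0..n}" using tree that by (auto simp: directed_tree_def F_def)
      then show ?thesis using that dom[of x y] underlyingI(1)[OF that] by (auto simp: F_def)
    qed
    then show ?thesis using \<open>(u, s) \<in> F\<^sup>*\<close> unfolding linked_within_def by (meson rtrancl_mono subrelI subsetD)
  qed
  ultimately have "(F, R) \<in> rooted_spanning_forests n E"
    unfolding rooted_spanning_forests_def by blast
  then show ?thesis by (simp add: forest_of_tree_def F_def R_def)
qed

text \<open>Two edges leaving a vertex lead to roots linked to it, hence to the same root, and
  \<open>acyclic_graph_out_edge_unique\<close> applies. An edge leaving a root would lead back to
  that root and close a directed cycle.\<close>

lemma tree_of_forest:
  assumes G: "simple_graph n E" and FR: "(F, R) \<in> rooted_spanning_forests n E"
  shows "F \<union> R \<times> {0} \<in> rooted_spanning_trees n E" "forest_of_tree (F \<union> R \<times> {0}) = (F, R)"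
proof -
  have und: "underlying F \<subseteq> E" and ac: "acyclic_graph (underlying F)" and as: "asym F"
    and R: "R \<subseteq> {1..n}"
    and unique: "\<And>u s s'. u \<in> {1..n} \<Longrightarrow> s \<in> R \<Longrightarrow> s' \<in> R \<Longrightarrow>
      (u, s) \<in> linked_within {1..n} (underlying F) \<Longrightarrow>
      (u, s') \<in> linked_within {1..n} (underlying F) \<Longrightarrow> s = s'"
    and reach: "\<And>u. u \<in> {1..n} \<Longrightarrow> \<exists>s\<in>R. (u, s) \<in> F\<^sup>*"
    using FR unfolding rooted_spanning_forests_def by blast+
  have edge: "u \<in> {1..n} \<and> v \<in> {1..n}" if "(u, v) \<in> F" for u v
  proof -
    have "{u, v} \<in> {{i, j} | i j. i \<in> {1..n} \<and> j \<in> {1..n} \<and> i \<noteq> j}"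
      using underlyingI(1)[OF that] und G unfolding simple_graph_def by blast
    then show ?thesis by (auto simp: doubleton_eq_iff)
  qed
  have linked: "(u, s) \<in> linked_within {1..n} (underlying F)" if "(u, s) \<in> F\<^sup>*" for u s
  proof -
    have "F \<subseteq> {(u, v). u \<in> {1..n} \<and> v \<in> {1..n} \<and> {u, v} \<in> underlying F}"
      by (rule subrelI) (simp only: mem_Collect_eq case_prod_conv edge underlyingI(1) simp_thms)
    then show ?thesis using that unfolding linked_within_def by (meson rtrancl_mono subsetD)
  qed
  have sv: "v = w" if uv: "(u, v) \<in> F" and uw: "(u, w) \<in> F" for u v w
  proof -
    obtain s s' where s: "s \<in> R" "(v, s) \<in> F\<^sup>*" "s' \<in> R" "(w, s') \<in> F\<^sup>*"
      using reach edge[OF uv] edge[OF uw] by blast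
    then have "(u, s) \<in> F\<^sup>*" "(u, s') \<in> F\<^sup>*"
      using uv uw by (meson converse_rtrancl_into_rtrancl)+
    then have "s = s'" using unique[of u s s'] s edge[OF uv] linked by blast
    then show ?thesis using acyclic_graph_out_edge_unique[OF ac as uv uw] s by blast
  qed
  have root: "(r, v) \<notin> F" if r: "r \<in> R" for r v
  proof
    assume rv: "(r, v) \<in> F"
    then obtain s where s: "s \<in> R" "(v, s) \<in> F\<^sup>*" using reach edge by blast
    then have "(r, s) \<in> F\<^sup>+" by (intro rtrancl_into_trancl2[OF rv])
    moreover have "r = s"
      using unique[of r r s] r s(1) edge[OF rv] linked[of r r] linked[OF trancl_into_rtrancl[OF \<open>(r, s) \<in> F\<^sup>+\<close>]]
      by blast
    ultimately show False using acyclic_graph_imp_acyclic[OF ac as] by (simp add: acyclic_def)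
  qed
  let ?T = "F \<union> R \<times> {0}"
  have "directed_tree n ?T"
    unfolding directed_tree_def
  proof (intro conjI ballI)
    show "single_valued ?T" using sv root by (auto intro!: single_valuedI)
    have "u \<in> Domain ?T" if "u \<in> {1..n}" for u
    proof -
      obtain s where "s \<in> R" "(u, s) \<in> F\<^sup>*" using reach \<open>u \<in> _\<close> by blast
      then show ?thesis by (cases "u = s") (auto elim: converse_rtranclE)
    qed
    then show "Domain ?T = {1..n}" using edge R by blast
    show "Range ?T \<subseteq> {0..n}" using edge by fastforce
    fix u assume "u \<in> {0..n}"
    show "(u, 0) \<in> ?T\<^sup>*"
    proof (cases "u = 0")
      case False
      then obtain s where s: "s \<in> R" "(u, s) \<in> F\<^sup>*" using reach[of u] \<open>u \<in> _\<close> by auto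
      then have "(u, s) \<in> ?T\<^sup>*" "(s, 0) \<in> ?T" using rtrancl_mono[of F ?T] by auto
      then show ?thesis by (rule rtrancl_into_rtrancl)
    qed simp
  qed
  moreover have "underlying ?T \<subseteq> coned_edges n E"
  proof
    fix e assume "e \<in> underlying ?T"
    then obtain u v where e: "e = {u, v}" "(u, v) \<in> ?T" unfolding underlying_def by blast
    then consider "(u, v) \<in> F" | "u \<in> R" "v = 0" by blast
    then show "e \<in> coned_edges n E"
    proof cases
      case 1
      then show ?thesis using e underlyingI(1)[OF 1] und by (auto simp: coned_edges_def)
    next
      case 2
      then have "e = {0, u}" "u \<in> {1..n}" using e R by auto
      then show ?thesis by (auto simp: coned_edges_def)
    qed
  qed
  ultimately show "?T \<in> rooted_spanning_trees n E" using rooted_spanning_trees_iff[OF G] by blast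
  have "v \<noteq> 0" if "(u, v) \<in> F" for u v using edge[OF that] by auto
  then show "forest_of_tree ?T = (F, R)" by (auto simp: forest_of_tree_def)
qed

lemma bij_betw_forest_of_tree:
  assumes "simple_graph n E"
  shows "bij_betw forest_of_tree (rooted_spanning_trees n E) (rooted_spanning_forests n E)"
proof (rule bij_betw_byWitness[where f' = "\<lambda>(F, R). F \<union> R \<times> {0}"])
  show "\<forall>T\<in>rooted_spanning_trees n E. (case forest_of_tree T of (F, R) \<Rightarrow> F \<union> R \<times> {0}) = T"
    by (auto simp: forest_of_tree_def intro: Nat.gr0I)
qed (use forest_of_tree_in_forests[OF assms] tree_of_forest[OF assms] in auto)

section \<open>Trees together with their labellings\<close>

lemma bij_betw_fst_noncrossing_trees:
  assumes "simple_graph n E"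
  shows "bij_betw fst (noncrossing_trees n E) (rooted_spanning_trees n E)"
proof (rule bij_betw_imageI)
  have tree: "directed_tree n T" if "T \<in> rooted_spanning_trees n E" for T
    using rooted_spanning_trees_iff[OF assms] that by blast
  show "inj_on fst (noncrossing_trees n E)"
    using noncrossing_labelling_unique[OF tree] by (auto simp: inj_on_def noncrossing_trees_def)
  show "fst ` noncrossing_trees n E = rooted_spanning_trees n E"
    using noncrossing_labelling_exists[OF tree] by (force simp: noncrossing_trees_def)
qed

theorem theorem4p13:
  fixes n :: nat and E :: "nat set set"
  assumes "simple_graph n E"
  shows "(\<forall>a \<in> standard_exponents TYPE('k::field) n E.
            exponent_of_tree n E (tree_of_exponent n E a) = a) \<and>
         (\<forall>T \<in> rooted_spanning_trees n E.
            tree_of_exponent n E (exponent_of_tree n E T) = T) \<and>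
         bij_betw (tree_of_exponent n E)
            (standard_exponents TYPE('k) n E) (rooted_spanning_trees n E) \<and>
         bij_betw (exponent_of_tree n E)
            (rooted_spanning_trees n E) (standard_exponents TYPE('k) n E) \<and>
         bij_betw forest_of_tree (rooted_spanning_trees n E) (rooted_spanning_forests n E) \<and>
         bij_betw fst (noncrossing_trees n E) (rooted_spanning_trees n E) \<and>
         bij_betw (\<lambda>(T, p). exponent_of_tree n E T)
            (noncrossing_trees n E) (standard_exponents TYPE('k) n E)"
proof -
  let ?A = "standard_exponents TYPE('k) n E" and ?B = "rooted_spanning_trees n E"
  have std: "?A = {a \<in> {1..n} \<rightarrow>\<^sub>E UNIV. \<not> generator_divides n E a}"
    by (simp only: standard_exponents_def monomial_in_tree_ideal_iff)
  have ext: "exponent_of_tree n E T \<in> {1..n} \<rightarrow>\<^sub>E UNIV" for T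
    by (simp add: exponent_of_tree_def Let_def)
  have ab: "\<forall>a\<in>?A. exponent_of_tree n E (tree_of_exponent n E a) = a"
  proof
    fix a assume a: "a \<in> ?A"
    show "exponent_of_tree n E (tree_of_exponent n E a) = a"
    \<comment> \<open>Both functions are \<open>undefined\<close> outside \<open>{1..n}\<close>, so
      agreement on \<open>{1..n}\<close> suffices.\<close>
    proof (rule PiE_ext[OF ext])
      show "a \<in> {1..n} \<rightarrow>\<^sub>E UNIV" using a std by blast
    qed (use tree_of_exponent(2)[OF assms] a std in blast)
  qed
  have ba: "\<forall>T\<in>?B. tree_of_exponent n E (exponent_of_tree n E T) = T"
    using tree_of_exponent_of_tree[OF assms] by blast
  have A: "tree_of_exponent n E ` ?A \<subseteq> ?B" using tree_of_exponent(1)[OF assms] std by blast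
  have B: "exponent_of_tree n E ` ?B \<subseteq> ?A"
    using exponent_of_tree_not_generator_divides[OF assms] ext std by blast
  have bij: "bij_betw (exponent_of_tree n E) ?B ?A"
    by (rule bij_betw_byWitness[OF ba ab B A])
  have "bij_betw (exponent_of_tree n E \<circ> fst) (noncrossing_trees n E) ?A"
    by (rule bij_betw_trans[OF bij_betw_fst_noncrossing_trees[OF assms] bij])
  then have "bij_betw (\<lambda>(T, p). exponent_of_tree n E T) (noncrossing_trees n E) ?A"
    by (simp add: comp_def case_prod_unfold)
  then show ?thesis
    using ab ba bij_betw_byWitness[OF ab ba A B] bij bij_betw_forest_of_tree[OF assms]
      bij_betw_fst_noncrossing_trees[OF assms] by blast
qed

end
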